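(* Fix $W,N,k\in\mathbb{N}_+$ and $K>0$, and let $(P,\preccurlyeq,d)$ be a $k$-point causal metric space with doubling constant $K$ and width $W$, whose points are feature vectors, $P=\{x_v\}_{v\in V}\subseteq\mathbb{R}^N$. Then there exist $D\in\mathcal{O}(\log(K))$, $T:=W$, a multilayer perceptron $\mathcal{E}:\mathbb{R}^N\to\mathbb{R}^{D+T}$, a map $\mathcal{T}:\mathbb{R}^{D+T}\to\mathbb{R}^T$ admitting a neural partial order representation, and a map $\mathcal{D}:\mathbb{R}^{D+T}\times\mathbb{R}^{D+T}\to[0,\infty)$ admitting a neural (quasi-)metric representation, such that for all $x_u,x_v\in P$: (i) (Order embedding) $x_u\preccurlyeq x_v$ if and only if $\mathcal{E}(x_u)\lesssim^{\mathcal{T}}\mathcal{E}(x_v)$; (ii) (Metric embedding) $d(x_u,x_v)\le\mathcal{D}(\mathcal{E}(x_u),\mathcal{E}(x_v))\le\mathcal{O}(\log(K)^5)\,d(x_u,x_v)$, where the implied constant is absolute. Furthermore, there is some $D\le k$ for which (ii) can be improved to $d(x_u,x_v)=\mathcal{D}(\mathcal{E}(x_u),\mathcal{E}(x_v))$ for all $x_u,x_v\in P$ (while (i) still holds). In either case: together, $\mathcal{D}$ and $\mathcal{T}$ are defined by a total of $D+T+8$ non-zero parameters; $\mathcal{E}$ depends on $\mathcal{O}\big(k^{5/2}D^4N\log(N)\log\big(k^2\operatorname{diam}(P,d)/\operatorname{sep}(P,d)\big)\big)$ non-zero parameters; consequently $\mathcal{D},\mathcal{T},\mathcal{E}$ together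 depend on at most $\mathcal{O}\big(D+T+k^{5/2}D^4N\log(N)\log\big(k^2\operatorname{diam}(P,d)/\operatorname{sep}(P,d)\big)\big)$ non-zero parameters.
   Context: A causal metric space is a triple $(P,d,\preccurlyeq)$ where $(P,d)$ is a metric space and $(P,\preccurlyeq)$ is a partially ordered set. An anti-chain is a subset $S\subseteq P$ such that no two distinct elements of $S$ are comparable; the width of the poset is the maximal cardinality of an anti-chain. The doubling constant of a metric space $(X,d)$ is the smallest integer $K\ge1$ such that every open ball $B(x,r)$ can be covered by at most $K$ open balls of radius $r/2$. $\operatorname{diam}(P,d)=\sup_{x,y\in P}d(x,y)$ and $\operatorname{sep}(P,d)=\inf_{x\ne y}d(x,y)$ (set to $1$ if $P$ is a singleton). For $s,l>0$ define $\sigma_{s,l}:\mathbb{R}\to\mathbb{R}$ by $\sigma_{s,l}(x)=\operatorname{sgn}(x)|x|^s$ if $|x|<1$ and $\operatorname{sgn}(x)|x|^l$ if $|x|\ge1$, where $\operatorname{sgn}(x)=1$ for $x\ge0$ and $-1$ for $x<0$; $\sigma\bullet$ denotes componentwise application. For $m\in\mathbb{N}_+$, $I^+_m$ denotes the set of $m\times m$ matrices of the form $\lambda I_m+|\tilde{W}|$ with $\lambda>0$, $\tilde W$ an arbitrary real $m\times m$ matrix and $|\cdot|$ the entrywise absolute value. For $x\in\mathbb{R}^{D+T}$, $x_{1:D}$ denotes its first $D$ coordinates and $x_{D+1:D+T}$ its last $T$ coordinates. A map $\mathcal{D}:\mathbb{R}^{D+T}\times\mathbb{R}^{D+T}\to[0,\infty)$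 has a neural (quasi-)metric representation if there are $J\in\mathbb{N}_+$, $s_0,l_0,\dots,s_J,l_J>0$, matrices $\mathsf{W}_j\in I^+_D$ for $j<J$ and $\mathsf{W}_J\in(0,\infty)^{1\times D}$ such that $\mathcal{D}(x,y)=\mathsf{W}_J\sigma_{s_J,l_J}\bullet(u_{J-1})$, $u_j=\mathsf{W}_j\sigma_{s_j,l_j}\bullet(u_{j-1})$ for $j=1,\dots,J-1$, and $u_0=|\sigma_{s_0,l_0}\bullet(x_{1:D})-\sigma_{s_0,l_0}\bullet(y_{1:D})|$ (absolute value componentwise). A map $\mathcal{T}:\mathbb{R}^{D+T}\to\mathbb{R}^T$ has a neural partial order representation if there are $\tilde J\in\mathbb{N}_+$, $\tilde s_1,\dots,\tilde s_{\tilde J}>0$, $\mathsf{V}_j\in I^+_T$ and $b_j\in\mathbb{R}^T$ with $\mathcal{T}(x)=z_{\tilde J}$, $z_j=\mathsf{V}_j\,\sigma_{\tilde s_j,\tilde s_j}\bullet(\mathrm{LR}\bullet(z_{j-1}))+b_j$ for $j=1,\dots,\tilde J$, and $z_0=x_{D+1:D+T}$, where $\mathrm{LR}$ is the LeakyReLU function ($x\mapsto x$ for $x\ge0$, $x\mapsto ax$ for $x<0$, fixed $a\in(0,1)$). The induced relation is $x\lesssim^{\mathcal{T}}y$ iff $\mathcal{T}(x)_t\le\mathcal{T}(y)_t$ for every coordinate $t=1,\dots,T$.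
   Formalization: Each logarithm in the O-bounds is replaced by max(1, log), since for N=1 the bound would be zero (false) and for k=1 log of diam/sep is undefined; "a total of D+T+8 non-zero parameters" is read as at most D+T+8; the multilayer perceptron is a ReLU network. *)

theory Defs
  imports "HOL-Analysis.Analysis"
begin

text \<open>Vectors of R^n are functions nat => real that vanish at indices >= n
  (coordinate i of the paper is index i-1 here).  Matrices are nat => nat => real.\<close>

definition vecs :: "nat \<Rightarrow> (nat \<Rightarrow> real) set" where
  "vecs n = {x. \<forall>i\<ge>n. x i = 0}"

definition sgn1 :: "real \<Rightarrow> real" where
  "sgn1 x = (if x \<ge> 0 then 1 else -1)"

definition sig :: "real \<Rightarrow> real \<Rightarrow> real \<Rightarrow> real" where
  "sig s l x = sgn1 x * (if \<bar>x\<bar> < 1 then \<bar>x\<bar> powr s else \<bar>x\<bar> powr l)"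

definition LR :: "real \<Rightarrow> real \<Rightarrow> real" where
  "LR a x = (if x \<ge> 0 then x else a * x)"

definition relu :: "real \<Rightarrow> real" where
  "relu x = max 0 x"

definition Iplus_mat :: "real \<Rightarrow> (nat \<Rightarrow> nat \<Rightarrow> real) \<Rightarrow> nat \<Rightarrow> nat \<Rightarrow> real" where
  "Iplus_mat lam Wt = (\<lambda>i j. (if i = j then lam else 0) + \<bar>Wt i j\<bar>)"

definition mv :: "nat \<Rightarrow> (nat \<Rightarrow> nat \<Rightarrow> real) \<Rightarrow> (nat \<Rightarrow> real) \<Rightarrow> nat \<Rightarrow> real" where
  "mv m A x = (\<lambda>i. if i < m then (\<Sum>j<m. A i j * x j) else 0)"

definition nnz_mat :: "nat \<Rightarrow> nat \<Rightarrow> (nat \<Rightarrow> nat \<Rightarrow> real) \<Rightarrow> nat" where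
  "nnz_mat m n A = card {(i, j). i < m \<and> j < n \<and> A i j \<noteq> 0}"

definition nnz_vec :: "nat \<Rightarrow> (nat \<Rightarrow> real) \<Rightarrow> nat" where
  "nnz_vec m v = card {i. i < m \<and> v i \<noteq> 0}"

text \<open>Parameters: depth J, exponents s_j, l_j (j = 0..J), for 1 <= j < J the matrix
  W_j = lam_j I_D + |Wt_j|, and the final row vector W_J.\<close>
record nqm_params =
  nqm_J :: nat
  nqm_s :: "nat \<Rightarrow> real"
  nqm_l :: "nat \<Rightarrow> real"
  nqm_lam :: "nat \<Rightarrow> real"
  nqm_Wt :: "nat \<Rightarrow> nat \<Rightarrow> nat \<Rightarrow> real"
  nqm_WJ :: "nat \<Rightarrow> real"

definition nqm_valid :: "nat \<Rightarrow> nqm_params \<Rightarrow> bool" where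
  "nqm_valid D p \<longleftrightarrow> nqm_J p \<ge> 1
     \<and> (\<forall>j \<le> nqm_J p. nqm_s p j > 0 \<and> nqm_l p j > 0)
     \<and> (\<forall>j \<in> {1..<nqm_J p}. nqm_lam p j > 0)
     \<and> (\<forall>i < D. nqm_WJ p i > 0)"

fun nqm_u :: "nat \<Rightarrow> nqm_params \<Rightarrow> (nat \<Rightarrow> real) \<Rightarrow> (nat \<Rightarrow> real) \<Rightarrow> nat \<Rightarrow> nat \<Rightarrow> real" where
  "nqm_u D p x y 0 =
     (\<lambda>i. if i < D then \<bar>sig (nqm_s p 0) (nqm_l p 0) (x i) - sig (nqm_s p 0) (nqm_l p 0) (y i)\<bar> else 0)"
| "nqm_u D p x y (Suc j) =
     mv D (Iplus_mat (nqm_lam p (Suc j)) (nqm_Wt p (Suc j)))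
        (\<lambda>i. sig (nqm_s p (Suc j)) (nqm_l p (Suc j)) (nqm_u D p x y j i))"

definition nqm_eval :: "nat \<Rightarrow> nqm_params \<Rightarrow> (nat \<Rightarrow> real) \<Rightarrow> (nat \<Rightarrow> real) \<Rightarrow> real" where
  "nqm_eval D p x y =
     (\<Sum>i<D. nqm_WJ p i * sig (nqm_s p (nqm_J p)) (nqm_l p (nqm_J p)) (nqm_u D p x y (nqm_J p - 1) i))"

definition nqm_nnz :: "nat \<Rightarrow> nqm_params \<Rightarrow> nat" where
  "nqm_nnz D p =
     card {j. j \<le> nqm_J p \<and> nqm_s p j \<noteq> 0} + card {j. j \<le> nqm_J p \<and> nqm_l p j \<noteq> 0}
     + card {j. j \<in> {1..<nqm_J p} \<and> nqm_lam p j \<noteq> 0}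
     + (\<Sum>j\<in>{1..<nqm_J p}. nnz_mat D D (nqm_Wt p j))
     + nnz_vec D (nqm_WJ p)"

record npo_params =
  npo_J :: nat
  npo_s :: "nat \<Rightarrow> real"
  npo_lam :: "nat \<Rightarrow> real"
  npo_Wt :: "nat \<Rightarrow> nat \<Rightarrow> nat \<Rightarrow> real"
  npo_b :: "nat \<Rightarrow> nat \<Rightarrow> real"

definition npo_valid :: "nat \<Rightarrow> npo_params \<Rightarrow> bool" where
  "npo_valid T p \<longleftrightarrow> npo_J p \<ge> 1
     \<and> (\<forall>j \<in> {1..npo_J p}. npo_s p j > 0 \<and> npo_lam p j > 0)"

fun npo_z :: "real \<Rightarrow> nat \<Rightarrow> nat \<Rightarrow> npo_params \<Rightarrow> (nat \<Rightarrow> real) \<Rightarrow> nat \<Rightarrow> nat \<Rightarrow> real" where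
  "npo_z a D T p x 0 = (\<lambda>t. if t < T then x (D + t) else 0)"
| "npo_z a D T p x (Suc j) =
     (\<lambda>t. mv T (Iplus_mat (npo_lam p (Suc j)) (npo_Wt p (Suc j)))
             (\<lambda>t'. sig (npo_s p (Suc j)) (npo_s p (Suc j)) (LR a (npo_z a D T p x j t'))) t
          + (if t < T then npo_b p (Suc j) t else 0))"

definition npo_eval :: "real \<Rightarrow> nat \<Rightarrow> nat \<Rightarrow> npo_params \<Rightarrow> (nat \<Rightarrow> real) \<Rightarrow> nat \<Rightarrow> real" where
  "npo_eval a D T p x = npo_z a D T p x (npo_J p)"

definition npo_nnz :: "nat \<Rightarrow> npo_params \<Rightarrow> nat" where
  "npo_nnz T p =
     card {j. j \<in> {1..npo_J p} \<and> npo_s p j \<noteq> 0} + card {j. j \<in> {1..npo_J p} \<and> npo_lam p j \<noteq> 0}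
     + (\<Sum>j\<in>{1..npo_J p}. nnz_mat T T (npo_Wt p j))
     + (\<Sum>j\<in>{1..npo_J p}. nnz_vec T (npo_b p j))"

definition pord :: "nat \<Rightarrow> (nat \<Rightarrow> real) \<Rightarrow> (nat \<Rightarrow> real) \<Rightarrow> bool" where
  "pord T u v \<longleftrightarrow> (\<forall>t < T. u t \<le> v t)"

text \<open>Layer widths dims = [n_0, ..., n_L]; layer l is the affine map
  h |-> W_l h + b_l from R^(n_l) to R^(n_(l+1)); ReLU after every layer but the last.\<close>
record mlp =
  mlp_dims :: "nat list"
  mlp_W :: "nat \<Rightarrow> nat \<Rightarrow> nat \<Rightarrow> real"
  mlp_b :: "nat \<Rightarrow> nat \<Rightarrow> real"

definition mlp_depth :: "mlp \<Rightarrow> nat" where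
  "mlp_depth E = length (mlp_dims E) - 1"

definition mlp_valid :: "nat \<Rightarrow> nat \<Rightarrow> mlp \<Rightarrow> bool" where
  "mlp_valid n m E \<longleftrightarrow> length (mlp_dims E) \<ge> 2 \<and> hd (mlp_dims E) = n
     \<and> last (mlp_dims E) = m \<and> (\<forall>w \<in> set (mlp_dims E). w > 0)"

definition mlp_affine :: "mlp \<Rightarrow> nat \<Rightarrow> (nat \<Rightarrow> real) \<Rightarrow> nat \<Rightarrow> real" where
  "mlp_affine E l h = (\<lambda>i. if i < mlp_dims E ! Suc l
      then (\<Sum>j < mlp_dims E ! l. mlp_W E l i j * h j) + mlp_b E l i else 0)"

fun mlp_hidden :: "mlp \<Rightarrow> (nat \<Rightarrow> real) \<Rightarrow> nat \<Rightarrow> nat \<Rightarrow> real" where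
  "mlp_hidden E x 0 = (\<lambda>i. if i < mlp_dims E ! 0 then x i else 0)"
| "mlp_hidden E x (Suc l) = (\<lambda>i. relu (mlp_affine E l (mlp_hidden E x l) i))"

definition mlp_eval :: "mlp \<Rightarrow> (nat \<Rightarrow> real) \<Rightarrow> nat \<Rightarrow> real" where
  "mlp_eval E x = mlp_affine E (mlp_depth E - 1) (mlp_hidden E x (mlp_depth E - 1))"

definition mlp_nnz :: "mlp \<Rightarrow> nat" where
  "mlp_nnz E = (\<Sum>l < mlp_depth E.
      nnz_mat (mlp_dims E ! Suc l) (mlp_dims E ! l) (mlp_W E l)
      + nnz_vec (mlp_dims E ! Suc l) (mlp_b E l))"

definition causal_metric_space :: "'a set \<Rightarrow> ('a \<Rightarrow> 'a \<Rightarrow> real) \<Rightarrow> 'a rel \<Rightarrow> bool" where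
  "causal_metric_space P d le \<longleftrightarrow> Metric_space P d \<and> partial_order_on P le"

definition antichain :: "'a set \<Rightarrow> 'a rel \<Rightarrow> 'a set \<Rightarrow> bool" where
  "antichain P le S \<longleftrightarrow> S \<subseteq> P \<and> (\<forall>x\<in>S. \<forall>y\<in>S. x \<noteq> y \<longrightarrow> (x, y) \<notin> le \<and> (y, x) \<notin> le)"

definition width :: "'a set \<Rightarrow> 'a rel \<Rightarrow> nat" where
  "width P le = Max (card ` {S. antichain P le S})"

definition doubling_const :: "'a set \<Rightarrow> ('a \<Rightarrow> 'a \<Rightarrow> real) \<Rightarrow> nat" where
  "doubling_const P d = (LEAST K::nat. K \<ge> 1 \<and>
     (\<forall>x\<in>P. \<forall>r>0. \<exists>C. C \<subseteq> P \<and> finite C \<and> card C \<le> K \<and>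
        {y\<in>P. d x y < r} \<subseteq> (\<Union>c\<in>C. {y\<in>P. d c y < r / 2})))"

definition diam_sp :: "'a set \<Rightarrow> ('a \<Rightarrow> 'a \<Rightarrow> real) \<Rightarrow> real" where
  "diam_sp P d = Sup {d x y | x y. x \<in> P \<and> y \<in> P}"

definition sep_sp :: "'a set \<Rightarrow> ('a \<Rightarrow> 'a \<Rightarrow> real) \<Rightarrow> real" where
  "sep_sp P d = (if card P = 1 then 1 else Inf {d x y | x y. x \<in> P \<and> y \<in> P \<and> x \<noteq> y})"

definition lg :: "real \<Rightarrow> real" where
  "lg x = max 1 (ln (max 1 x))"

end

theory Submission
  imports Defs "HOL-Probability.Probability"
begin

text \<open>Since the network \<open>E\<close> can interpolate arbitrary values on a finite set, one has to find
  coordinates \<open>F\<close>, a weight \<open>w\<close> and an exponent \<open>p\<close> for which \<open>\<Sum>i<D. w * \<bar>F x i - F y i\<bar> powr p\<close> is close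
  or equal to \<open>d x y\<close>, and monotone coordinates that determine the order.

  \<^item> Order: by Dilworth's theorem \<open>P\<close> splits into \<open>W\<close> chains, and counting the elements of each chain
    below a point embeds \<open>P\<close> into \<open>\<real>\<^sup>W\<close>.

  \<^item> Exact metric: as \<open>p\<close> tends to infinity, powers of distances below 1 disappear, so \<open>k\<close> coordinates
    can prescribe all \<open>k (k - 1) / 2\<close> values up to a small error, which a contraction removes.

  \<^item> Dimension \<open>O(log K)\<close>: here \<open>p = 2\<close>, and \<open>F\<close> embeds the square root of the metric. At a scale \<open>r\<close>, take maxima
    over a net of cones with independent truncated geometric heights. These maxima are Lipschitz,
    and by memorylessness two points at distance at least \<open>r\<close> get close values with small probability in each
    coordinate. The local lemma makes one choice of heights good for all pairs at that scale. As
    distances are allowed to be distorted by powers of \<open>log K\<close>, the scales can be taken so sparse that four classes of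
    coordinates suffice to keep them from interfering.\<close>


section \<open>The local lemma and truncated geometric variables\<close>

text \<open>The dimension may not depend on the number of points, which rules out a union bound over
  all pairs. The local lemma needs local events, hence the truncation of the heights at
  \<open>m\<close>; its error is paid once for each of the at most \<open>K ^ i\<close> net points
  near a point, where \<open>2 ^ i\<close> is polynomial in \<open>m\<close>. The exponent 5 comes
  from the following balance, with \<open>K \<le> 2 ^ a\<close> and up to constants. Truncation asks
  for m >= Q * a * i, where 1/Q is the failure probability in one coordinate. The local lemma with
  O(a) coordinates asks that log Q be comparable to i, hence to log a, so Q has to be a power of a.
  The distortion is the number a of coordinates times the weight m times the squared Hoelder
  constant m^2; a fifth power therefore allows m to be a^(4/3). The excess a^(1/3) over a is shared
  between Q and the factor i.\<close>

text \<open>\<open>N S\<close> stands for the probability that all bad events in \<open>S\<close> are avoided, and \<open>\<Gamma> e\<close> for the events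
  that are not independent of \<open>e\<close>.\<close>

lemma lovasz_local_lemma:
  fixes N :: "'e set \<Rightarrow> real" and p :: real and k :: nat
  assumes fin: "finite E" and N0: "0 < N {}" and p0: "0 \<le> p"
    and step: "\<And>e S. S \<subseteq> E \<Longrightarrow> e \<in> E - S \<Longrightarrow> N S - p * N (S - \<Gamma> e) \<le> N (insert e S)"
    and deg: "\<And>e. e \<in> E \<Longrightarrow> card (E \<inter> \<Gamma> e) \<le> k"
    and k1: "1 \<le> k" and pk: "4 * p * real k \<le> 1"
  shows "0 < N E"
proof -
  have p4: "4 * p \<le> 1"
    using mult_left_mono[of 1 "real k" "4 * p"] k1 p0 pk by simp
  \<comment> \<open>The strengthened induction: given that \<open>S\<close> is avoided, a further
    event occurs with probability at most \<open>2 * p\<close>, twice the bound available when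
    conditioning only on \<open>S - \<Gamma> e\<close>.\<close>
  have main: "0 < N S \<and> (\<forall>e\<in>E - S. (1 - 2 * p) * N S \<le> N (insert e S))" if "S \<subseteq> E" for S
    using that
  proof (induction "card S" arbitrary: S rule: less_induct)
    case less
    have finS: "finite S" using less.prems fin finite_subset by blast
    have pos: "0 < N S"
    proof (cases "S = {}")
      case False
      then obtain e where e: "e \<in> S" by blast
      have "card (S - {e}) < card S" by (rule card_Diff1_less[OF finS e])
      from less.hyps[OF this] less.prems
      have IH: "0 < N (S - {e})" "\<forall>x\<in>E - (S - {e}). (1 - 2 * p) * N (S - {e}) \<le> N (insert x (S - {e}))"
        by auto
      have "e \<in> E - (S - {e})" "insert e (S - {e}) = S" using e less.prems by auto
      then have "0 < N (S - {e})" "(1 - 2 * p) * N (S - {e}) \<le> N S"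
        using IH by metis+
      moreover have "0 < (1 - 2 * p) * N (S - {e})"
        using calculation(1) p4 by (intro mult_pos_pos) auto
      ultimately show ?thesis by linarith
    qed (simp add: N0)
    have "(1 - 2 * p) * N S \<le> N (insert e S)" if e: "e \<in> E - S" for e
    proof -
      let ?R = "S - \<Gamma> e"
      \<comment> \<open>The neighbours of \<open>e\<close> are put back one at a time. Each
        intermediate set still misses some \<open>x \<in> S\<close>, so the induction hypothesis
        applies to it.\<close>
      have grow: "(1 - 2 * p) ^ card T * N ?R \<le> N (?R \<union> T)" if "T \<subseteq> S \<inter> \<Gamma> e" for T
      proof -
        have "finite T" using that finS finite_subset by blast
        then show ?thesis using that
        proof (induction T rule: finite_induct)
          case (insert x T)
          have sub: "?R \<union> T \<subset> S" using insert by auto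
          then have "card (?R \<union> T) < card S" using finS psubset_card_mono by blast
          from less.hyps[OF this] sub less.prems insert
          have "(1 - 2 * p) * N (?R \<union> T) \<le> N (insert x (?R \<union> T))" by auto
          moreover have "(1 - 2 * p) * ((1 - 2 * p) ^ card T * N ?R) \<le> (1 - 2 * p) * N (?R \<union> T)"
            using insert p4 by (intro mult_left_mono) auto
          ultimately show ?case using insert by (simp add: mult_ac)
        qed simp
      qed
      have "card (S \<inter> \<Gamma> e) \<le> k"
        using deg[of e] e less.prems fin card_mono[of "E \<inter> \<Gamma> e" "S \<inter> \<Gamma> e"] by fastforce
      then have "(1 - 2 * p) ^ k \<le> (1 - 2 * p) ^ card (S \<inter> \<Gamma> e)"
        using p0 p4 by (intro power_decreasing) auto
      \<comment> \<open>By Bernoulli, \<open>4 * p * real k \<le> 1\<close> limits the loss from all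
        neighbours to a factor 2; this is the origin of the \<open>2 * p\<close>.\<close>
      moreover have "1 - real k * (2 * p) \<le> (1 - 2 * p) ^ k"
        using Bernoulli_inequality[of "- (2 * p)" k] p4 by simp
      ultimately have half: "1 / 2 \<le> (1 - 2 * p) ^ card (S \<inter> \<Gamma> e)"
        using pk by (simp add: field_simps)
      have R0: "0 \<le> N ?R"
      proof (cases "?R = S")
        case False
        then have "card ?R < card S" using finS by (intro psubset_card_mono) auto
        from less.hyps[OF this] less.prems show ?thesis by force
      qed (use pos in simp)
      have "?R \<union> (S \<inter> \<Gamma> e) = S" by blast
      then have "1 / 2 * N ?R \<le> N S"
        using grow[of "S \<inter> \<Gamma> e"] mult_right_mono[OF half R0] by simp
      then have "p * N ?R \<le> p * (2 * N S)" using p0 by (intro mult_left_mono) auto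
      then show ?thesis using step[OF less.prems e] by (simp add: algebra_simps)
    qed
    with pos show ?case by blast
  qed
  then show ?thesis by blast
qed

text \<open>Deferred decisions: once the coordinates outside \<open>X\<close> are fixed,
  \<open>R\<close> is decided and only those in \<open>X\<close> are random. Since
  \<open>cond\<close> is uniform in the fixed part \<open>g\<close>, the bound survives integration
  over \<open>g\<close>, although \<open>E\<close> may depend on all coordinates.\<close>

lemma prob_Pi_pmf_resample:
  assumes fin: "finite I" and XI: "X \<subseteq> I"
    and indep: "\<And>u u'. (\<And>i. i \<notin> X \<Longrightarrow> u i = u' i) \<Longrightarrow> R u \<longleftrightarrow> R u'"
    and cond: "\<And>g. measure_pmf.prob (Pi_pmf X dflt p) {f. E (\<lambda>i. if i \<in> X then f i else g i)} \<le> c"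
    and c0: "0 \<le> c"
  shows "measure_pmf.prob (Pi_pmf I dflt p) {u. E u \<and> R u}
          \<le> c * measure_pmf.prob (Pi_pmf I dflt p) {u. R u}"
proof -
  let ?X = "Pi_pmf X dflt p" and ?Y = "Pi_pmf (I - X) dflt p"
  let ?h = "\<lambda>f g i. if i \<in> X then f i else g i"
  have IX: "I = X \<union> (I - X)" using XI by blast
  have "Pi_pmf I dflt p = map_pmf (\<lambda>(f, g). ?h f g) (pair_pmf ?X ?Y)"
    by (subst IX, subst Pi_pmf_union) (use fin XI finite_subset in auto)
  also have "\<dots> = map_pmf (\<lambda>(g, f). ?h f g) (pair_pmf ?Y ?X)"
    by (subst pair_commute_pmf) (simp add: pmf.map_comp o_def case_prod_unfold cong: if_cong)
  finally have *: "Pi_pmf I dflt p = map_pmf (\<lambda>(g, f). ?h f g) (pair_pmf ?Y ?X)" .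
  have Rh: "R (?h f g) \<longleftrightarrow> R g" for f g by (rule indep) simp
  have em: "emeasure (Pi_pmf I dflt p) {u. A u}
      = (\<integral>\<^sup>+g. emeasure ?X {f. A (?h f g)} \<partial>?Y)" for A
  proof -
    have "emeasure (Pi_pmf I dflt p) {u. A u}
        = (\<integral>\<^sup>+z. indicator {u. A u} (case z of (g, f) \<Rightarrow> ?h f g) \<partial>pair_pmf ?Y ?X)"
      unfolding nn_integral_map_pmf[symmetric] *[symmetric] by simp
    also have "\<dots> = (\<integral>\<^sup>+g. \<integral>\<^sup>+f. indicator {f. A (?h f g)} f \<partial>?X \<partial>?Y)"
      unfolding nn_integral_pair_pmf' by (simp add: indicator_def)
    finally show ?thesis by simp
  qed
  have "emeasure (Pi_pmf I dflt p) {u. E u \<and> R u}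
      \<le> (\<integral>\<^sup>+g. ennreal c * indicator {g. R g} g \<partial>?Y)"
    unfolding em Rh
  proof (rule nn_integral_mono)
    fix g
    show "emeasure ?X {f. E (?h f g) \<and> R g} \<le> ennreal c * indicator {g. R g} g"
      using cond[of g] by (cases "R g") (simp_all add: measure_pmf.emeasure_eq_measure ennreal_leI)
  qed
  also have "\<dots> = ennreal c * emeasure ?Y {g. R g}"
    by (subst nn_integral_cmult) simp_all
  also have "emeasure ?Y {g. R g} = emeasure (Pi_pmf I dflt p) {u. R u}"
  proof -
    have "emeasure ?X {f. R g} = indicator {g. R g} g" for g
      using measure_pmf.emeasure_space_1[of ?X] by (cases "R g") simp_all
    then show ?thesis unfolding em Rh by simp
  qed
  finally show ?thesis
    using c0 by (simp add: measure_pmf.emeasure_eq_measure flip: ennreal_mult)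
qed

section \<open>Truncated geometric heights\<close>

lemma prob_geometric_pmf_atLeast:
  assumes "0 < p" "p \<le> (1::real)"
  shows "measure_pmf.prob (geometric_pmf p) {k..} = (1 - p) ^ k"
proof -
  have "measure_pmf.prob (geometric_pmf p) {..<k} = (\<Sum>i<k. (1 - p) ^ i * p)"
    using assms by (subst measure_measure_pmf_finite) auto
  also have "\<dots> = 1 - (1 - p) ^ k"
    by (induction k) (simp_all add: algebra_simps)
  finally have "measure_pmf.prob (geometric_pmf p) (UNIV - {..<k}) = (1 - p) ^ k"
    using measure_pmf.prob_compl[of "{..<k}" "geometric_pmf p"] by simp
  moreover have "UNIV - {..<k} = {k..}" by auto
  ultimately show ?thesis by simp
qed

text \<open>For \<open>e = 0\<close> and \<open>y = t * x\<close> this is the chord bound for the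
  product of the \<open>1 - t * x v\<close>, which is convex in \<open>t\<close> on the unit
  interval as a product of nonnegative nonincreasing affine functions. Since all factors lie between
  0 and 1, the deviations \<open>e\<close> merely add up.\<close>

lemma prod_one_minus_le_convex:
  fixes x y :: "'a \<Rightarrow> real"
  assumes "finite X" and t: "0 \<le> t" "t \<le> 1" and e: "0 \<le> e"
    and "\<And>v. v \<in> X \<Longrightarrow> 0 \<le> x v \<and> x v \<le> 1" "\<And>v. v \<in> X \<Longrightarrow> 0 \<le> y v \<and> y v \<le> 1"
    and "\<And>v. v \<in> X \<Longrightarrow> t * x v - e \<le> y v"
  shows "(\<Prod>v\<in>X. 1 - y v) \<le> (1 - t) + t * (\<Prod>v\<in>X. 1 - x v) + real (card X) * e"
  using assms(1,5-)
proof (induction X rule: finite_induct)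
  case (insert a X)
  let ?P = "\<Prod>v\<in>X. 1 - x v" and ?A = "\<Prod>v\<in>X. 1 - y v"
  have P: "0 \<le> ?P" "?P \<le> 1" using insert by (auto intro!: prod_nonneg prod_le_1)
  have A: "0 \<le> ?A" "?A \<le> 1" using insert by (auto intro!: prod_nonneg prod_le_1)
  have a: "0 \<le> x a" "x a \<le> 1" "t * x a - e \<le> y a" using insert by auto
  have tx: "0 \<le> t * x a" "t * x a \<le> 1" using a t by (auto intro: mult_le_one)
  have "(1 - y a) * ?A \<le> (1 - t * x a + e) * ?A"
    using a A by (intro mult_right_mono) auto
  also have "\<dots> \<le> (1 - t * x a) * ?A + e"
    using mult_left_le[of ?A e] A e by (simp add: algebra_simps)
  also have "(1 - t * x a) * ?A \<le> (1 - t * x a) * ((1 - t) + t * ?P + real (card X) * e)"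
    using insert tx by (intro mult_left_mono) auto
  also have "\<dots> \<le> (1 - t * x a) * ((1 - t) + t * ?P) + real (card X) * e"
  proof -
    have "(1 - t * x a) * (real (card X) * e) \<le> 1 * (real (card X) * e)"
      using tx e by (intro mult_right_mono) auto
    then show ?thesis by (simp add: algebra_simps)
  qed
  \<comment> \<open>The two sides differ by exactly
    \<open>(t * x a) * ((1 - t) * (1 - ?P))\<close>.\<close>
  also have "(1 - t * x a) * ((1 - t) + t * ?P) \<le> (1 - t) + t * ((1 - x a) * ?P)"
  proof -
    have "0 \<le> (t * x a) * ((1 - t) * (1 - ?P))" using tx t P by auto
    then show ?thesis by (simp add: algebra_simps)
  qed
  finally have "(1 - y a) * ?A \<le> (1 - t) + t * ((1 - x a) * ?P) + real (card X) * e + e"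
    by simp
  moreover have "real (card (insert a X)) * e = real (card X) * e + e"
    using insert.hyps by (simp add: distrib_right)
  ultimately show ?case using insert.hyps by simp
qed simp

text \<open>The event says that the largest excess of a height over its threshold is exactly 0. A
  height that reaches a threshold stops there only with probability \<open>q\<close>, and the chord
  bound gives \<open>q\<close> once for the whole family instead of once for each index. The size of
  \<open>X\<close> multiplies only the truncation error, so a point may see many cones.\<close>

lemma prob_truncated_geometric_threshold:
  fixes thr :: "'v \<Rightarrow> int" and q :: real
  assumes fin: "finite X" and q: "0 < q" "q \<le> 1"
  shows "measure_pmf.prob (Pi_pmf X 0 (\<lambda>_. geometric_pmf q))
      {f. (\<forall>v\<in>X. int (min m (f v)) \<le> thr v) \<and> (\<exists>v\<in>X. thr v \<le> int (min m (f v)))}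
    \<le> q + real (card X) * (1 - q) ^ m"
proof -
  define w where "w = geometric_pmf q"
  define H where "H k = measure_pmf.prob w {j. k \<le> int (min m j)}" for k :: int
  let ?W = "Pi_pmf X 0 (\<lambda>_. geometric_pmf q)"
  have H01: "0 \<le> H k" "H k \<le> 1" for k unfolding H_def by auto
  have Hnat: "H (int k) = (if k \<le> m then (1 - q) ^ k else 0)" for k
  proof -
    have "{j. int k \<le> int (min m j)} = (if k \<le> m then {k..} else {})" by auto
    then show ?thesis unfolding H_def w_def
      by (simp add: prob_geometric_pmf_atLeast q)
  qed
  have Hneg: "H k = 1" if "k \<le> 0" for k
  proof -
    have "{j. k \<le> int (min m j)} = UNIV" using that by auto
    then show ?thesis unfolding H_def by simp
  qed
  \<comment> \<open>Memorylessness is an equality for \<open>0 \<le> k < m\<close>. At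
    \<open>k = m\<close> the tail drops to 0, which \<open>(1 - q) ^ m\<close> pays for; for
    negative \<open>k\<close> both tails are 1.\<close>
  have Hstep: "(1 - q) * H k - (1 - q) ^ m \<le> H (k + 1)" for k
  proof (cases "k \<le> -1")
    case True
    then have "H k = 1" "H (k + 1) = 1" by (auto intro: Hneg)
    moreover have "0 \<le> (1 - q) ^ m" using q by (intro zero_le_power) simp
    moreover have "(1 - q) - (1 - q) ^ m \<le> 1 - 0" using q calculation(3) by (intro diff_mono) auto
    ultimately show ?thesis by (simp only: mult_1_right diff_zero)
  next
    case False
    then obtain n where n: "k = int n" using zero_le_imp_eq_int[of k] by auto
    have Hk: "H k = (if n \<le> m then (1 - q) ^ n else 0)"
      "H (k + 1) = (if Suc n \<le> m then (1 - q) ^ Suc n else 0)"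
      using Hnat[of n] Hnat[of "Suc n"] by (simp_all add: n add.commute)
    have pw: "0 \<le> (1 - q) ^ m" using q by (intro zero_le_power) simp
    consider "n < m" | "n = m" | "n > m" by linarith
    then show ?thesis
    proof cases
      case 2
      have "(1 - q) * (1 - q) ^ m \<le> 1 * (1 - q) ^ m" using q pw by (intro mult_right_mono) auto
      then show ?thesis unfolding Hk using 2 by simp
    qed (use pw in \<open>simp_all add: Hk\<close>)
  qed
  have le: "measure_pmf.prob w {j. int (min m j) \<le> k} = 1 - H (k + 1)" for k
  proof -
    have "{j. int (min m j) \<le> k} = space w - {j. k + 1 \<le> int (min m j)}" by auto
    then show ?thesis unfolding H_def by (simp only: measure_pmf.prob_compl sets_measure_pmf UNIV_I)
  qed
  have lt: "measure_pmf.prob w {j. int (min m j) < k} = 1 - H k" for k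
  proof -
    have "{j. int (min m j) < k} = {j. int (min m j) \<le> k - 1}" by auto
    then show ?thesis by (simp only: le diff_add_cancel)
  qed
  let ?L = "Pi X (\<lambda>v. {j. int (min m j) \<le> thr v})" and ?S = "Pi X (\<lambda>v. {j. int (min m j) < thr v})"
  have "{f. (\<forall>v\<in>X. int (min m (f v)) \<le> thr v) \<and> (\<exists>v\<in>X. thr v \<le> int (min m (f v)))} = ?L - ?S"
    by (auto simp: Pi_def not_less)
  moreover have "?S \<subseteq> ?L" by (auto simp: Pi_def intro: less_imp_le)
  ultimately have "measure_pmf.prob ?W {f. (\<forall>v\<in>X. int (min m (f v)) \<le> thr v) \<and> (\<exists>v\<in>X. thr v \<le> int (min m (f v)))}
      = measure_pmf.prob ?W ?L - measure_pmf.prob ?W ?S"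
    by (simp add: measure_pmf.finite_measure_Diff)
  also have "\<dots> = (\<Prod>v\<in>X. 1 - H (thr v + 1)) - (\<Prod>v\<in>X. 1 - H (thr v))"
    by (simp only: measure_Pi_pmf_Pi[OF fin] le lt flip: w_def)
  also have "\<dots> \<le> q + real (card X) * (1 - q) ^ m"
  proof -
    have "(\<Prod>v\<in>X. 1 - H (thr v + 1))
        \<le> (1 - (1 - q)) + (1 - q) * (\<Prod>v\<in>X. 1 - H (thr v)) + real (card X) * (1 - q) ^ m"
      by (rule prod_one_minus_le_convex) (use fin q H01 Hstep in auto)
    moreover have "(1 - q) * (\<Prod>v\<in>X. 1 - H (thr v)) \<le> 1 * (\<Prod>v\<in>X. 1 - H (thr v))"
      using q H01 by (intro mult_right_mono prod_nonneg) auto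
    ultimately show ?thesis by simp
  qed
  finally show ?thesis .
qed

section \<open>Embedding doubling metrics\<close>

text \<open>The covering condition whose least solution is \<open>doubling_const\<close>.\<close>

definition doubling :: "'a set \<Rightarrow> ('a \<Rightarrow> 'a \<Rightarrow> real) \<Rightarrow> nat \<Rightarrow> bool" where
  "doubling M d K \<longleftrightarrow> K \<ge> 1 \<and> (\<forall>x\<in>M. \<forall>r>0. \<exists>C. C \<subseteq> M \<and> finite C \<and> card C \<le> K \<and>
     {y\<in>M. d x y < r} \<subseteq> (\<Union>c\<in>C. {y\<in>M. d c y < r / 2}))"

section \<open>Packing bounds and nets\<close>

lemma doubling_iterate:
  assumes "doubling M d K" "x \<in> M" "0 < r"
  shows "\<exists>C\<subseteq>M. finite C \<and> card C \<le> K ^ i \<and>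
    {y\<in>M. d x y < r} \<subseteq> (\<Union>c\<in>C. {y\<in>M. d c y < r / 2 ^ i})"
proof (induction i)
  case 0
  show ?case by (rule exI[of _ "{x}"]) (use assms in auto)
next
  case (Suc i)
  then obtain C where C: "C \<subseteq> M" "finite C" "card C \<le> K ^ i"
    "{y\<in>M. d x y < r} \<subseteq> (\<Union>c\<in>C. {y\<in>M. d c y < r / 2 ^ i})" by blast
  define D where "D c C' \<longleftrightarrow> C' \<subseteq> M \<and> finite C' \<and> card C' \<le> K \<and>
     {y\<in>M. d c y < r / 2 ^ i} \<subseteq> (\<Union>c\<in>C'. {y\<in>M. d c y < r / 2 ^ i / 2})" for c C'
  have "\<exists>C'. D c C'" if "c \<in> C" for c
  proof -
    have "c \<in> M" "0 < r / 2 ^ i" using that C(1) assms(3) by auto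
    then show ?thesis
      unfolding D_def by (rule assms(1)[unfolded doubling_def, THEN conjunct2, rule_format])
  qed
  then obtain G where "\<And>c. c \<in> C \<Longrightarrow> D c (G c)" by metis
  then have G: "G c \<subseteq> M \<and> finite (G c) \<and> card (G c) \<le> K \<and>
     {y\<in>M. d c y < r / 2 ^ i} \<subseteq> (\<Union>c'\<in>G c. {y\<in>M. d c' y < r / 2 ^ i / 2})" if "c \<in> C" for c
    using that unfolding D_def by simp
  have "card (\<Union>c\<in>C. G c) \<le> (\<Sum>c\<in>C. card (G c))" using C(2) by (rule card_UN_le)
  also have "\<dots> \<le> card C * K" using G sum_bounded_above[of C "\<lambda>c. card (G c)" K] by simp
  also have "\<dots> \<le> K ^ Suc i" using C(3) by simp
  finally have "card (\<Union>c\<in>C. G c) \<le> K ^ Suc i" .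
  moreover have "{y\<in>M. d x y < r} \<subseteq> (\<Union>c\<in>(\<Union>c\<in>C. G c). {y\<in>M. d c y < r / 2 ^ Suc i})"
  proof
    fix y assume "y \<in> {y\<in>M. d x y < r}"
    then obtain c where c: "c \<in> C" "y \<in> M" "d c y < r / 2 ^ i" using C(4) by blast
    with G[OF c(1)] obtain c' where "c' \<in> G c" "d c' y < r / 2 ^ i / 2" by blast
    with c show "y \<in> (\<Union>c\<in>(\<Union>c\<in>C. G c). {y\<in>M. d c y < r / 2 ^ Suc i})"
      by (auto simp: field_simps)
  qed
  moreover have "(\<Union>c\<in>C. G c) \<subseteq> M" "finite (\<Union>c\<in>C. G c)" using G C by auto
  ultimately show ?case by blast
qed

context Metric_space
begin

text \<open>A ball of radius at most \<open>\<rho> / 2\<close> contains at most one point of a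
  \<open>\<rho>\<close>-separated set, so sending each point to the centre of a covering ball is
  injective.\<close>

lemma card_separated_le:
  assumes "doubling M d K" and x: "x \<in> M" and R: "0 < R" and i: "R / 2 ^ i \<le> \<rho> / 2"
    and S: "S \<subseteq> {y\<in>M. d x y < R}" and sep: "\<And>y z. y \<in> S \<Longrightarrow> z \<in> S \<Longrightarrow> y \<noteq> z \<Longrightarrow> \<rho> \<le> d y z"
  shows "card S \<le> K ^ i"
proof -
  obtain C where C: "C \<subseteq> M" "finite C" "card C \<le> K ^ i"
    "{y\<in>M. d x y < R} \<subseteq> (\<Union>c\<in>C. {y\<in>M. d c y < R / 2 ^ i})"
    using doubling_iterate[OF assms(1) x R] by blast
  have "\<forall>y\<in>S. \<exists>c\<in>C. d c y < R / 2 ^ i" using S C(4) by blast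
  then obtain c where c: "\<And>y. y \<in> S \<Longrightarrow> c y \<in> C \<and> d (c y) y < R / 2 ^ i" by metis
  have "inj_on c S"
  proof (rule inj_onI, rule ccontr)
    fix y z assume yz: "y \<in> S" "z \<in> S" "c y = c z" "y \<noteq> z"
    have "d y z \<le> d (c y) y + d (c y) z"
      using triangle[of y "c y" z] commute[of y "c y"] yz S C(1) c by auto
    also have "\<dots> < \<rho>" using c[OF yz(1)] c[OF yz(2)] yz(3) i by (simp only:) linarith
    finally show False using sep[OF yz(1,2,4)] by simp
  qed
  then have "card S \<le> card C" using c C(2) by (intro card_inj_on_le) auto
  with C(3) show ?thesis by simp
qed

text \<open>A separated set of largest cardinality is a net, because a point at distance at least
  \<open>\<rho>\<close> from all of it could be added.\<close>

lemma exists_maximal_separated: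
  assumes fin: "finite M" and "0 < \<rho>"
  obtains F where "F \<subseteq> M" "\<And>y z. y \<in> F \<Longrightarrow> z \<in> F \<Longrightarrow> y \<noteq> z \<Longrightarrow> \<rho> \<le> d y z"
    "\<And>x. x \<in> M \<Longrightarrow> \<exists>y\<in>F. d x y < \<rho>"
proof -
  let ?P = "\<lambda>F. F \<subseteq> M \<and> (\<forall>y\<in>F. \<forall>z\<in>F. y \<noteq> z \<longrightarrow> \<rho> \<le> d y z)"
  let ?c = "card ` Collect ?P"
  have "finite (Collect ?P)" by (rule finite_subset[of _ "Pow M"]) (use fin in auto)
  then have c: "finite ?c" by (rule finite_imageI)
  have "?P {}" by simp
  then have "card ({}::'a set) \<in> ?c" by (intro imageI CollectI)
  then have "?c \<noteq> {}" by (metis empty_iff)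
  from Max_in[OF c this] obtain F where F: "?P F" and Fmax: "card F = Max ?c" by auto
  have max: "card G \<le> card F" if "?P G" for G
    unfolding Fmax by (intro Max_ge[OF c] imageI CollectI that)
  have "\<exists>y\<in>F. d x y < \<rho>" if x: "x \<in> M" for x
  proof (rule ccontr)
    assume *: "\<not> ?thesis"
    then have "x \<notin> F" using x assms(2) zero[of x x] by fastforce
    moreover have "?P (insert x F)" using * F x commute by (auto simp: not_less)
    moreover have "finite F" using F fin finite_subset by blast
    ultimately show False using max[of "insert x F"] by simp
  qed
  then show ?thesis using F by (intro that[of F]) auto
qed

text \<open>Heights are truncated at \<open>m\<close> and cones have slope \<open>4 m / r\<close>, so the value at \<open>x\<close> only depends on the net
  points within \<open>r / 4\<close>. Conditioning on everything else, a value in the unit window around \<open>\<phi> u t y\<close> means that some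
  height near \<open>x\<close> reaches its threshold and none exceeds it.\<close>

lemma single_scale_map:
  fixes m Q n i K :: nat and B r :: real
  assumes fin: "finite M" and ne: "M \<noteq> {}" and dbl: "doubling M d K" and r: "0 < r"
    and m: "1 \<le> m" and B: "1 \<le> B" and Q: "1 \<le> Q"
    and i: "512 * B * real m \<le> 2 ^ i"
    and trunc: "real (K ^ i) * (1 - 1 / real Q) ^ m \<le> 1 / real Q"
    and lll: "4 * (2 / real Q) ^ n * real ((K ^ i)\<^sup>2) \<le> 1"
  obtains \<phi> :: "nat \<Rightarrow> 'a \<Rightarrow> real" where
    "\<And>t x y. \<bar>\<phi> t x - \<phi> t y\<bar> \<le> real m"
    "\<And>t x y. x \<in> M \<Longrightarrow> y \<in> M \<Longrightarrow> \<bar>\<phi> t x - \<phi> t y\<bar> \<le> 4 * real m * d x y / r"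
    "\<And>x y. x \<in> M \<Longrightarrow> y \<in> M \<Longrightarrow> r \<le> d x y \<Longrightarrow> d x y < B * r \<Longrightarrow> \<exists>t<n. 1 / 4 \<le> \<bar>\<phi> t x - \<phi> t y\<bar>"
proof -
  \<comment> \<open>Cones have slope \<open>4 * m / r\<close>, so a move by less than
    \<open>\<rho>\<close> changes a value by at most 1/16. Snapping both points of a pair to the net
    therefore keeps at least 1/4 of a gap of 1/2.\<close>
  define \<rho> where "\<rho> = r / (64 * real m)"
  have \<rho>: "0 < \<rho>" "\<rho> \<le> r / 64" using r m by (auto simp: \<rho>_def field_simps)
  obtain F where FM: "F \<subseteq> M" and sep: "\<And>y z. y \<in> F \<Longrightarrow> z \<in> F \<Longrightarrow> y \<noteq> z \<Longrightarrow> \<rho> \<le> d y z"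
    and cov: "\<And>x. x \<in> M \<Longrightarrow> \<exists>y\<in>F. d x y < \<rho>"
    using exists_maximal_separated[OF fin \<rho>(1)] by blast
  have finF: "finite F" using FM fin finite_subset by blast
  have neF: "F \<noteq> {}" using ne cov by blast
  define a where "a x v = 4 * real m * d x v / r" for x v
  define bump where "bump u t x v = max 0 (real (min m (u (v, t))) - a x v)"
    for u :: "'a \<times> nat \<Rightarrow> nat" and t x v
  define \<phi> where "\<phi> u t x = Max (bump u t x ` F)" for u t x
  define near where "near x = {v\<in>F. d x v < r / 4}" for x
  define q where "q = 1 / real Q"
  have q: "0 < q" "q \<le> 1" using Q by (auto simp: q_def)
  have bump_le: "bump u t x v \<le> \<phi> u t x" if "v \<in> F" for u t x v
    unfolding \<phi>_def using finF that by simp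
  have \<phi>_le: "\<phi> u t x \<le> c" if "\<And>v. v \<in> F \<Longrightarrow> bump u t x v \<le> c" for u t x c
    unfolding \<phi>_def using finF neF that by simp
  have \<phi>_attained: "\<exists>v\<in>F. \<phi> u t x = bump u t x v" for u t x
    unfolding \<phi>_def using Max_in[of "bump u t x ` F"] finF neF by blast
  have a0: "0 \<le> a x v" for x v using r by (simp add: a_def)
  have bump0: "0 \<le> bump u t x v" for u t x v by (simp add: bump_def)
  have bumpm: "bump u t x v \<le> real m" for u t x v
    using a0[of x v] by (auto simp: bump_def)
  have \<phi>0: "0 \<le> \<phi> u t x" for u t x using neF bump_le bump0 order_trans by blast
  have \<phi>m: "\<phi> u t x \<le> real m" for u t x using bumpm by (intro \<phi>_le)
  have far: "bump u t x v = 0" if "\<not> d x v < r / 4" for u t x v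
  proof -
    have "real m \<le> a x v" using that r m by (simp add: a_def field_simps)
    then show ?thesis by (simp add: bump_def)
  qed
  have bump_nz: "bump u t x v = real (min m (u (v, t))) - a x v" if "bump u t x v \<noteq> 0" for u t x v
    using that by (simp add: bump_def max_def split: if_splits)
  have phi_local: "\<phi> u t x = \<phi> u' t x" if "\<And>v. v \<in> near x \<Longrightarrow> u (v, t) = u' (v, t)" for u u' t x
  proof -
    have "bump u t x v = bump u' t x v" if v: "v \<in> F" for v
    proof (cases "d x v < r / 4")
      case True
      then have "u (v, t) = u' (v, t)" using that v \<open>\<And>v. v \<in> near x \<Longrightarrow> u (v, t) = u' (v, t)\<close>
        by (simp add: near_def)
      then show ?thesis by (simp add: bump_def)
    qed (simp add: far)
    then have "bump u t x ` F = bump u' t x ` F" by (rule image_cong[OF refl])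
    then show ?thesis by (simp only: \<phi>_def)
  qed
  have lip1: "\<phi> u t x \<le> \<phi> u t y + 4 * real m * d x y / r" if "x \<in> M" "y \<in> M" for u t x y
  proof (rule \<phi>_le)
    fix v assume v: "v \<in> F"
    have "d y v \<le> d x v + d x y" using triangle[of y x v] that v FM commute[of x y] by auto
    then have "4 * real m * d y v / r \<le> 4 * real m * (d x v + d x y) / r"
      using r by (intro divide_right_mono mult_left_mono) auto
    then have "a y v \<le> a x v + 4 * real m * d x y / r"
      by (simp add: a_def distrib_left add_divide_distrib)
    moreover have "0 \<le> 4 * real m * d x y / r" using r by simp
    ultimately have "bump u t x v \<le> bump u t y v + 4 * real m * d x y / r"
      unfolding bump_def by linarith
    then show "bump u t x v \<le> \<phi> u t y + 4 * real m * d x y / r"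
      using bump_le[OF v, of u t y] by linarith
  qed
  have lip: "\<bar>\<phi> u t x - \<phi> u t y\<bar> \<le> 4 * real m * d x y / r" if "x \<in> M" "y \<in> M" for u t x y
    using lip1[OF that, of u t] lip1[OF that(2,1), of u t] commute[of x y] by (simp add: abs_le_iff)
  \<comment> \<open>The distance window is widened on both sides, because snapping to the net
    changes a distance by less than \<open>2 * \<rho> \<le> r / 32\<close>.\<close>
  define E where "E = {(x, y) \<in> F \<times> F. r / 2 \<le> d x y \<and> d x y \<le> 2 * B * r}"
  define close where "close u t e \<longleftrightarrow> \<bar>\<phi> u t (fst e) - \<phi> u t (snd e)\<bar> < 1 / 2" for u t e
  define bad where "bad u e \<longleftrightarrow> (\<forall>t<n. close u t e)" for u e
  \<comment> \<open>Deliberately one-sided: only heights near the first point of \<open>e\<close>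
    are resampled, those near the second are conditioned on. Hence \<open>e'\<close> matters only if
    one of its points sees a height near \<open>fst e\<close>.\<close>
  define \<Gamma> where "\<Gamma> e = {e'. near (fst e) \<inter> (near (fst e') \<union> near (snd e')) \<noteq> {}}" for e :: "'a \<times> 'a"
  define I where "I = F \<times> {..<n}"
  define P where "P = measure_pmf.prob (Pi_pmf I 0 (\<lambda>_. geometric_pmf q))"
  define N where "N S = P {u. \<forall>e\<in>S. \<not> bad u e}" for S
  have finI: "finite I" using finF by (simp add: I_def)
  have finE: "finite E" by (rule finite_subset[of _ "F \<times> F"]) (auto simp: E_def finF)
  have card_ball: "card {v\<in>F. d x v < 4 * B * r} \<le> K ^ i" if x: "x \<in> F" for x
  proof (rule card_separated_le[OF dbl])
    show "x \<in> M" using x FM by blast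
    show "0 < 4 * B * r" using B r by simp
    \<comment> \<open>This is the hypothesis \<open>512 * B * real m \<le> 2 ^ i\<close>, since
      \<open>\<rho> / 2 = r / (128 * m)\<close>.\<close>
    show "4 * B * r / 2 ^ i \<le> \<rho> / 2"
    proof -
      have "512 * B * real m * r \<le> 2 ^ i * r" using i r by (intro mult_right_mono) auto
      then show ?thesis using m by (simp add: \<rho>_def field_simps)
    qed
  qed (use FM sep in auto)
  have card_near: "card (near x) \<le> K ^ i" if x: "x \<in> F" for x
  proof -
    have "r / 4 \<le> 4 * B * r" using mult_right_mono[of "1/4" "4 * B" r] B r by simp
    then have "near x \<subseteq> {v\<in>F. d x v < 4 * B * r}" by (auto simp: near_def)
    from card_mono[OF _ this] card_ball[OF x] finF show ?thesis by simp
  qed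
  \<comment> \<open>Consequently resampling near \<open>x\<close> leaves the value at
    \<open>y\<close> fixed, and the window to be avoided at \<open>x\<close> is known
    beforehand.\<close>
  have near_disj: "near x \<inter> near y = {}" if "(x, y) \<in> E" for x y
  proof (rule ccontr)
    assume "near x \<inter> near y \<noteq> {}"
    then obtain v where v: "v \<in> F" "d x v < r / 4" "d y v < r / 4" by (auto simp: near_def)
    have "d x y \<le> d x v + d v y" using triangle[of x v y] that v FM by (auto simp: E_def)
    with v that show False by (auto simp: E_def commute)
  qed
  have resample: "measure_pmf.prob (Pi_pmf (near x \<times> {t}) 0 (\<lambda>_. geometric_pmf q))
      {f. close (\<lambda>i. if i \<in> near x \<times> {t} then f i else g i) t (x, y)} \<le> 2 * q"
    if xy: "(x, y) \<in> E" for x y t g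
  proof -
    let ?X = "near x \<times> {t}"
    let ?h = "\<lambda>f i. if i \<in> ?X then f i else g i"
    have xF: "x \<in> F" and xM: "x \<in> M" using xy FM by (auto simp: E_def)
    have finX: "finite ?X" using finF by (auto simp: near_def)
    define z where "z = \<phi> g t y"
    \<comment> \<open>The window for a height at \<open>v\<close> is open, of length 1, with upper
      end \<open>z + 1 / 2 + a x v\<close>. An integer below the upper end is at most this floor,
      and an integer above the lower end is at least this floor.\<close>
    define thr where "thr = (\<lambda>(v, t'::nat). \<lfloor>z + 1 / 2 + a x v\<rfloor>)"
    have hz: "\<phi> (?h f) t y = z" for f
      unfolding z_def by (rule phi_local) (use near_disj[OF xy] in auto)
    have clz: "\<bar>\<phi> (?h f) t x - z\<bar> < 1 / 2" if "close (?h f) t (x, y)" for f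
      using that unfolding close_def fst_conv snd_conv hz .
    have "{f. close (?h f) t (x, y)} \<subseteq>
       {f. (\<forall>i\<in>?X. int (min m (f i)) \<le> thr i) \<and> (\<exists>i\<in>?X. thr i \<le> int (min m (f i)))}"
    proof safe
      fix f v assume cl: "close (?h f) t (x, y)" and v: "v \<in> near x"
      have "real (min m (f (v, t))) - a x v \<le> bump (?h f) t x v"
        using v by (simp add: bump_def)
      also have "\<dots> \<le> \<phi> (?h f) t x" using v by (intro bump_le) (simp add: near_def)
      also have "\<dots> < z + 1 / 2" using clz[OF cl] by linarith
      finally show "int (min m (f (v, t))) \<le> thr (v, t)"
        by (simp add: thr_def le_floor_iff)
    next
      fix f assume cl: "close (?h f) t (x, y)"
      have lo: "z - 1 / 2 < \<phi> (?h f) t x" using clz[OF cl] by linarith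
      obtain v where v: "v \<in> F" "\<phi> (?h f) t x = bump (?h f) t x v" using \<phi>_attained by blast
      have "\<exists>v\<in>near x. z - 1 / 2 < real (min m (f (v, t))) - a x v"
      proof (cases "bump (?h f) t x v = 0")
        case True
        \<comment> \<open>The value 0 need not come from a positive cone. As \<open>x\<close> is
          itself a net point, its own height serves as witness: it is nonnegative, while
          \<open>z - 1 / 2\<close> is negative in this case.\<close>
        have "x \<in> near x" using xF xM r by (simp add: near_def)
        moreover have "a x x = 0" using xM by (simp add: a_def)
        ultimately show ?thesis using lo v True by (intro bexI[of _ x]) auto
      next
        case False
        then have "v \<in> near x" using far v(1) by (auto simp: near_def)
        moreover from False have "bump (?h f) t x v = real (min m (?h f (v, t))) - a x v"
          by (rule bump_nz)
        ultimately show ?thesis using lo v(2) by (intro bexI[of _ v]) auto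
      qed
      then obtain v where v: "v \<in> near x" "z - 1 / 2 < real (min m (f (v, t))) - a x v" by blast
      have "thr (v, t) < int (min m (f (v, t))) + 1"
      proof -
        have "z + 1 / 2 + a x v < of_int (int (min m (f (v, t))) + 1)" using v(2) by simp
        then show ?thesis unfolding thr_def prod.case by (simp only: floor_less_iff)
      qed
      then show "\<exists>i\<in>?X. thr i \<le> int (min m (f i))" using v(1) by (intro bexI[of _ "(v, t)"]) auto
    qed
    then have "measure_pmf.prob (Pi_pmf ?X 0 (\<lambda>_. geometric_pmf q)) {f. close (?h f) t (x, y)}
      \<le> measure_pmf.prob (Pi_pmf ?X 0 (\<lambda>_. geometric_pmf q))
        {f. (\<forall>i\<in>?X. int (min m (f i)) \<le> thr i) \<and> (\<exists>i\<in>?X. thr i \<le> int (min m (f i)))}"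
      by (rule measure_pmf.finite_measure_mono) simp
    also have "\<dots> \<le> q + real (card ?X) * (1 - q) ^ m"
      by (rule prob_truncated_geometric_threshold[OF finX q])
    also have "real (card ?X) * (1 - q) ^ m \<le> real (K ^ i) * (1 - q) ^ m"
      using card_near[OF xF] q by (intro mult_right_mono) (auto simp: card_cartesian_product)
    also have "\<dots> \<le> q" using trunc by (simp add: q_def)
    finally show ?thesis by simp
  qed
  have step: "N S - (2 * q) ^ n * N (S - \<Gamma> e) \<le> N (insert e S)" if S: "S \<subseteq> E" and e: "e \<in> E - S" for S e
  proof -
    obtain x y where xy: "e = (x, y)" "(x, y) \<in> E" using e by (cases e) auto
    define R where "R u \<longleftrightarrow> (\<forall>e\<in>S - \<Gamma> e. \<not> bad u e)" for u
    have R_indep: "R u \<longleftrightarrow> R u'" if "\<And>i. i \<notin> near x \<times> {t} \<Longrightarrow> u i = u' i" for u u' t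
    proof -
      have "\<phi> u s z = \<phi> u' s z" if "near x \<inter> near z = {}" for s z
        by (rule phi_local) (use that \<open>\<And>i. i \<notin> near x \<times> {t} \<Longrightarrow> u i = u' i\<close> in auto)
      then have "bad u e' \<longleftrightarrow> bad u' e'" if "e' \<in> S - \<Gamma> e" for e'
        using that xy by (auto simp: bad_def close_def \<Gamma>_def Int_Un_distrib)
      then show ?thesis by (simp add: R_def)
    qed
    \<comment> \<open>One coordinate at a time: the heights in
      \<open>near x \<times> {\<tau>}\<close> influence neither the earlier coordinates nor
      \<open>R\<close>, so each new coordinate contributes another factor
      \<open>2 * q\<close>.\<close>
    have prod: "P {u. (\<forall>t<\<tau>. close u t e) \<and> R u} \<le> (2 * q) ^ \<tau> * P {u. R u}" if "\<tau> \<le> n" for \<tau>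
      using that
    proof (induction \<tau>)
      case (Suc \<tau>)
      have indep: "((\<forall>t<\<tau>. close u t e) \<and> R u) \<longleftrightarrow> ((\<forall>t<\<tau>. close u' t e) \<and> R u')"
        if "\<And>i. i \<notin> near x \<times> {\<tau>} \<Longrightarrow> u i = u' i" for u u'
      proof -
        have "\<phi> u t z = \<phi> u' t z" if "t < \<tau>" for t z
          by (rule phi_local) (use that \<open>\<And>i. i \<notin> near x \<times> {\<tau>} \<Longrightarrow> u i = u' i\<close> in auto)
        then show ?thesis using R_indep[OF that] by (auto simp: close_def)
      qed
      have "P {u. close u \<tau> e \<and> (\<forall>t<\<tau>. close u t e) \<and> R u}
          \<le> 2 * q * P {u. (\<forall>t<\<tau>. close u t e) \<and> R u}"
        unfolding P_def
      proof (rule prob_Pi_pmf_resample[where X = "near x \<times> {\<tau>}"])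
        show "near x \<times> {\<tau>} \<subseteq> I" using Suc.prems by (auto simp: I_def near_def)
        show "measure_pmf.prob (Pi_pmf (near x \<times> {\<tau>}) 0 (\<lambda>_. geometric_pmf q))
            {f. close (\<lambda>i. if i \<in> near x \<times> {\<tau>} then f i else g i) \<tau> e} \<le> 2 * q" for g
          unfolding xy(1) by (rule resample[OF xy(2)])
      qed (fact finI, rule indep, assumption, use q in simp)
      also have "\<dots> \<le> 2 * q * ((2 * q) ^ \<tau> * P {u. R u})"
        using Suc q by (intro mult_left_mono) auto
      also have "{u. close u \<tau> e \<and> (\<forall>t<\<tau>. close u t e) \<and> R u} = {u. (\<forall>t<Suc \<tau>. close u t e) \<and> R u}"
        by (auto simp: less_Suc_eq)
      finally show ?case by (simp only: power_Suc mult.assoc)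
    qed simp
    have "P {u. \<forall>e\<in>S. \<not> bad u e} \<le> P ({u. \<forall>e\<in>insert e S. \<not> bad u e} \<union> {u. bad u e \<and> R u})"
      unfolding P_def by (rule measure_pmf.finite_measure_mono) (auto simp: R_def)
    also have "\<dots> \<le> P {u. \<forall>e\<in>insert e S. \<not> bad u e} + P {u. bad u e \<and> R u}"
      unfolding P_def by (rule measure_Un_le) auto
    also have "P {u. bad u e \<and> R u} \<le> (2 * q) ^ n * P {u. R u}"
      unfolding bad_def by (rule prod) simp
    finally show ?thesis unfolding N_def R_def by simp
  qed
  \<comment> \<open>A pair in \<open>\<Gamma> e\<close> has one point within \<open>r / 2\<close> of
    \<open>x\<close> and the other at most \<open>2 * B * r\<close> further, so both lie in the ball
    counted by \<open>card_ball\<close>.\<close>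
  have deg: "card (E \<inter> \<Gamma> e) \<le> (K ^ i)\<^sup>2" if e: "e \<in> E" for e
  proof -
    obtain x y where xy: "e = (x, y)" "x \<in> F" using e by (auto simp: E_def)
    let ?Bl = "{v\<in>F. d x v < 4 * B * r}"
    have rB: "r \<le> B * r" using mult_right_mono[of 1 B r] B r by simp
    have "E \<inter> \<Gamma> e \<subseteq> ?Bl \<times> ?Bl"
    proof
      fix e' assume e': "e' \<in> E \<inter> \<Gamma> e"
      obtain x' y' where xy': "e' = (x', y')" "x' \<in> F" "y' \<in> F" "d x' y' \<le> 2 * B * r"
        using e' by (auto simp: E_def)
      have close2: "d x z < r / 2" if "near x \<inter> near z \<noteq> {}" "z \<in> F" for z
      proof -
        from that obtain v where v: "v \<in> F" "d x v < r / 4" "d z v < r / 4" by (auto simp: near_def)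
        then have "x \<in> M" "v \<in> M" "z \<in> M" using that(2) xy(2) FM by auto
        from triangle[OF this] v show ?thesis using commute[of v z] by linarith
      qed
      have "near x \<inter> near x' \<noteq> {} \<or> near x \<inter> near y' \<noteq> {}"
        using e' xy xy' by (auto simp: \<Gamma>_def)
      then have "d x x' < r / 2 \<or> d x y' < r / 2" using close2 xy' by blast
      moreover have "d x y' \<le> d x x' + d x' y'" "d x x' \<le> d x y' + d x' y'"
        using triangle[of x x' y'] triangle[of x y' x'] FM xy xy' commute[of x' y'] by auto
      ultimately have "d x x' \<le> r / 2 + 2 * (B * r)" "d x y' \<le> r / 2 + 2 * (B * r)"
        using xy'(4) rB r by (auto simp: mult.assoc)
      moreover have "r / 2 + 2 * (B * r) < 4 * B * r" using rB r by linarith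
      ultimately have "d x x' < 4 * B * r \<and> d x y' < 4 * B * r" by (meson le_less_trans)
      then show "e' \<in> ?Bl \<times> ?Bl" using xy' by simp
    qed
    then have "card (E \<inter> \<Gamma> e) \<le> card (?Bl \<times> ?Bl)" using finF by (intro card_mono) auto
    also have "\<dots> \<le> (K ^ i)\<^sup>2"
      using card_ball[OF xy(2)] by (simp add: card_cartesian_product power2_eq_square mult_mono)
    finally show ?thesis .
  qed
  have "0 < N E"
  proof (rule lovasz_local_lemma[OF finE, where \<Gamma> = \<Gamma> and p = "(2 * q) ^ n" and k = "(K ^ i)\<^sup>2"])
    show "1 \<le> (K ^ i)\<^sup>2" using dbl by (simp add: doubling_def)
    show "4 * (2 * q) ^ n * real ((K ^ i)\<^sup>2) \<le> 1" using lll by (simp add: q_def)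
  qed (use step deg q in \<open>auto simp: N_def P_def\<close>)
  then have "{u. \<forall>e\<in>E. \<not> bad u e} \<noteq> {}" unfolding N_def P_def by (metis less_irrefl measure_empty)
  then obtain u where u: "\<And>e. e \<in> E \<Longrightarrow> \<not> bad u e" by blast
  show ?thesis
  proof
    show "\<bar>\<phi> u t x - \<phi> u t y\<bar> \<le> real m" for t x y
      using \<phi>0[of u t x] \<phi>0[of u t y] \<phi>m[of u t x] \<phi>m[of u t y] by linarith
    show "\<bar>\<phi> u t x - \<phi> u t y\<bar> \<le> 4 * real m * d x y / r" if "x \<in> M" "y \<in> M" for t x y
      using lip[OF that] .
    fix x y assume xy: "x \<in> M" "y \<in> M" "r \<le> d x y" "d x y < B * r"
    obtain x' y' where x': "x' \<in> F" "d x x' < \<rho>" and y': "y' \<in> F" "d y y' < \<rho>" using cov xy by meson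
    have M': "x' \<in> M" "y' \<in> M" using x' y' FM by auto
    have tr: "d x y \<le> d x x' + d x' y' + d y y'" "d x' y' \<le> d x x' + d x y + d y y'"
      using triangle[of x x' y] triangle[of x' y' y] triangle[of x' x y'] triangle[of x y y'] xy M'
        commute[of y y'] commute[of x x'] by auto
    have rB: "r \<le> B * r" using mult_right_mono[of 1 B r] B r by simp
    have "(x', y') \<in> E" using tr x' y' xy \<rho> r rB by (auto simp: E_def)
    from u[OF this] obtain t where t: "t < n" "1 / 2 \<le> \<bar>\<phi> u t x' - \<phi> u t y'\<bar>"
      by (auto simp: bad_def close_def not_less)
    have small: "\<bar>\<phi> u t z - \<phi> u t z'\<bar> \<le> 1 / 16" if "z \<in> M" "z' \<in> M" "d z z' < \<rho>" for z z'
    proof -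
      have "4 * real m * d z z' / r \<le> 4 * real m * \<rho> / r"
        using that r by (intro divide_right_mono mult_left_mono) auto
      also have "\<dots> = 1 / 16" using r m by (simp add: \<rho>_def)
      finally show ?thesis using lip[OF that(1,2), of u t] by linarith
    qed
    have "1 / 4 \<le> \<bar>\<phi> u t x - \<phi> u t y\<bar>"
      using small[OF xy(1) M'(1) x'(2)] small[OF xy(2) M'(2) y'(2)] t(2) by linarith
    with t(1) show "\<exists>t<n. 1 / 4 \<le> \<bar>\<phi> u t x - \<phi> u t y\<bar>" by blast
  qed
qed

end

section \<open>Superposing the scales\<close>

lemma sum_power_lower_le:
  fixes s :: real
  assumes s: "2 \<le> s" and "finite A" and A: "\<And>l. l \<in> A \<Longrightarrow> l + k \<le> j"
  shows "(\<Sum>l\<in>A. s ^ l) * s ^ k \<le> 2 * s ^ j"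
proof -
  have "(\<Sum>l\<in>A. s ^ l) * s ^ k = (\<Sum>u\<in>(\<lambda>l. l + k) ` A. s ^ u)"
    by (subst sum.reindex) (auto simp: sum_distrib_right power_add)
  also have "\<dots> \<le> (\<Sum>u\<le>j. s ^ u)" using A s by (intro sum_mono2) auto
  also have "\<dots> \<le> 2 * s ^ j"
  proof (induction j)
    case (Suc j)
    have "2 * s ^ j \<le> s * s ^ j" using s by (intro mult_right_mono) auto
    with Suc show ?case by simp
  qed simp
  finally show ?thesis .
qed

lemma sum_inverse_power_upper_le:
  fixes s :: real
  assumes s: "2 \<le> s" and "finite A" and A: "\<And>l. l \<in> A \<Longrightarrow> j \<le> l"
  shows "(\<Sum>l\<in>A. 1 / s ^ l) \<le> 2 / s ^ j"
proof -
  obtain n where n: "\<And>l. l \<in> A \<Longrightarrow> l < n" using \<open>finite A\<close> finite_nat_set_iff_bounded by auto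
  have "(\<Sum>l\<in>A. 1 / s ^ l) \<le> (\<Sum>l\<in>{j..<j + n}. 1 / s ^ l)"
    using A n s by (intro sum_mono2) (auto intro!: trans_less_add2)
  also have "\<dots> \<le> 2 / s ^ j - 2 / s ^ (j + n)"
  proof (induction n)
    case 0
    then show ?case using s by (simp add: field_simps)
  next
    case (Suc n)
    have "2 / s ^ Suc (j + n) \<le> s / s ^ Suc (j + n)"
      using s by (intro divide_right_mono) auto
    also have "\<dots> = 1 / s ^ (j + n)" using s by simp
    finally have "2 / s ^ Suc (j + n) \<le> 1 / s ^ (j + n)" .
    moreover have "2 / s ^ (j + n) = 1 / s ^ (j + n) + 1 / s ^ (j + n)" by simp
    ultimately show ?case using Suc by simp
  qed
  also have "\<dots> \<le> 2 / s ^ j" using s by simp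
  finally show ?thesis .
qed

context Metric_space
begin

text \<open>Weighted by \<open>\<rho> l\<close>, the square root of its scale, level
  \<open>l\<close> separates a pair by at most \<open>m * \<rho> l\<close> and by at most
  \<open>4 * m * d x y / \<rho> l\<close>. The bounds balance where \<open>\<rho> l\<close> is
  comparable to the root of the distance and decay geometrically on either side. With the weight
  \<open>R l\<close> instead, the Lipschitz bound would be the same for every coarse level and their
  sum would not be controlled.\<close>

lemma multiscale_embedding:
  fixes s m :: real and n :: nat
  assumes fin: "finite M" and m: "1 \<le> m" and s0: "0 \<le> s" and sm: "128 * m \<le> s\<^sup>2"
    and scale: "\<And>r. 0 < r \<Longrightarrow> \<exists>\<phi>::nat \<Rightarrow> 'a \<Rightarrow> real. (\<forall>t x y. \<bar>\<phi> t x - \<phi> t y\<bar> \<le> m) \<and>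
      (\<forall>t. \<forall>x\<in>M. \<forall>y\<in>M. \<bar>\<phi> t x - \<phi> t y\<bar> \<le> 4 * m * d x y / r) \<and>
      (\<forall>x\<in>M. \<forall>y\<in>M. r \<le> d x y \<longrightarrow> d x y < s\<^sup>2 * r \<longrightarrow> (\<exists>t<n. 1 / 4 \<le> \<bar>\<phi> t x - \<phi> t y\<bar>))"
  obtains F :: "'a \<Rightarrow> nat \<Rightarrow> real" where
    "\<And>x y i. x \<in> M \<Longrightarrow> y \<in> M \<Longrightarrow> (F x i - F y i)\<^sup>2 \<le> 144 * m\<^sup>2 * d x y"
    "\<And>x y. x \<in> M \<Longrightarrow> y \<in> M \<Longrightarrow> x \<noteq> y \<Longrightarrow> \<exists>i<4 * n. d x y \<le> 64 * s\<^sup>2 * (F x i - F y i)\<^sup>2"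
proof -
  have s2: "2 \<le> s"
  proof (rule power2_le_imp_le)
    show "2\<^sup>2 \<le> s\<^sup>2" using sm m by simp
  qed (fact s0)
  let ?S = "(\<lambda>(x, y). d x y) ` {(x, y) \<in> M \<times> M. x \<noteq> y}"
  have "finite {(x, y) \<in> M \<times> M. x \<noteq> y}"
    by (rule finite_subset[of _ "M \<times> M"]) (use fin in auto)
  then have finS: "finite ?S" by (rule finite_imageI)
  \<comment> \<open>The inserted 1 keeps minimum and maximum defined when there are no two distinct
    points.\<close>
  define \<sigma> where "\<sigma> = Min (insert 1 ?S)"
  define \<Delta> where "\<Delta> = Max (insert 1 ?S)"
  have S_pos: "0 < z" if z: "z \<in> ?S" for z
  proof -
    obtain x y where xy: "x \<in> M" "y \<in> M" "x \<noteq> y" "z = d x y" using z by auto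
    then show ?thesis using nonneg[of x y] zero[OF xy(1,2)] by linarith
  qed
  have \<sigma>: "0 < \<sigma>" unfolding \<sigma>_def using finS S_pos by (subst Min_gr_iff) auto
  have \<sigma>_le: "\<sigma> \<le> d x y" if "x \<in> M" "y \<in> M" "x \<noteq> y" for x y
    unfolding \<sigma>_def by (rule Min_le) (use finS that in auto)
  have \<Delta>_ge: "d x y \<le> \<Delta>" if "x \<in> M" "y \<in> M" "x \<noteq> y" for x y
    unfolding \<Delta>_def by (rule Max_ge) (use finS that in auto)
  define \<rho> where "\<rho> l = sqrt \<sigma> * s ^ l" for l :: nat
  define R where "R l = (\<rho> l)\<^sup>2" for l
  have \<rho>_pos: "0 < \<rho> l" for l using \<sigma> s2 by (simp add: \<rho>_def)
  have R_pos: "0 < R l" for l using \<rho>_pos[of l] by (simp add: R_def)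
  have R_Suc: "R (Suc l) = s\<^sup>2 * R l" for l by (simp add: R_def \<rho>_def power_mult_distrib)
  have R0: "R 0 = \<sigma>" using \<sigma> by (simp add: R_def \<rho>_def)
  \<comment> \<open>Neither bound of the conclusion involves the number \<open>J\<close> of levels,
    so any \<open>J\<close> beyond the largest distance will do.\<close>
  obtain J where J: "\<Delta> / \<sigma> < s ^ J" using real_arch_pow[of s "\<Delta> / \<sigma>"] s2 by auto
  have RJ: "\<Delta> < R J"
  proof -
    have "\<Delta> < \<sigma> * s ^ J" using J \<sigma> by (simp add: field_simps)
    also have "\<dots> \<le> \<sigma> * (s ^ J)\<^sup>2"
      using \<sigma> s2 one_le_power[of s J] by (intro mult_left_mono) (auto simp: power2_eq_square)
    also have "\<dots> = R J" using \<sigma> by (simp add: R_def \<rho>_def power_mult_distrib)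
    finally show ?thesis .
  qed
  have level: "\<exists>j<J. R j \<le> d x y \<and> d x y < R (Suc j)" if xy: "x \<in> M" "y \<in> M" "x \<noteq> y" for x y
  proof -
    let ?P = "\<lambda>l. d x y < R l"
    have PJ: "?P J" using \<Delta>_ge[OF xy] RJ by simp
    define l where "l = (LEAST l. ?P l)"
    have l: "?P l" "l \<le> J" unfolding l_def using PJ by (auto intro: LeastI Least_le)
    have "l \<noteq> 0"
    proof
      assume "l = 0"
      then show False using l(1) \<sigma>_le[OF xy] R0 by simp
    qed
    then obtain j where j: "l = Suc j" using not0_implies_Suc by blast
    have "\<not> ?P j" using not_less_Least[of j ?P] j l_def by simp
    then show ?thesis using l j by (intro exI[of _ j]) auto
  qed
  obtain \<phi> :: "nat \<Rightarrow> nat \<Rightarrow> 'a \<Rightarrow> real" where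
    \<phi>1: "\<And>l t x y. \<bar>\<phi> l t x - \<phi> l t y\<bar> \<le> m" and
    \<phi>2: "\<And>l t x y. x \<in> M \<Longrightarrow> y \<in> M \<Longrightarrow> \<bar>\<phi> l t x - \<phi> l t y\<bar> \<le> 4 * m * d x y / R l" and
    \<phi>3: "\<And>l x y. x \<in> M \<Longrightarrow> y \<in> M \<Longrightarrow> R l \<le> d x y \<Longrightarrow> d x y < s\<^sup>2 * R l
      \<Longrightarrow> \<exists>t<n. 1 / 4 \<le> \<bar>\<phi> l t x - \<phi> l t y\<bar>"
    using scale[OF R_pos] by metis
  \<comment> \<open>Coordinate \<open>i\<close> encodes a coordinate \<open>i div 4\<close> of the
    single-scale maps together with the residue class \<open>i mod 4\<close> of the levels it
    superposes.\<close>
  define C where "C i = {l. l < J \<and> l mod 4 = i mod 4}" for i :: nat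
  have finC: "finite (C i)" for i by (simp add: C_def)
  define F where "F x i = (\<Sum>l\<in>C i. \<rho> l * \<phi> l (i div 4) x)" for x i
  have diff: "F x i - F y i = (\<Sum>l\<in>C i. \<rho> l * (\<phi> l (i div 4) x - \<phi> l (i div 4) y))" for x y i
    by (simp add: F_def sum_subtractf right_diff_distrib)
  \<comment> \<open>\<open>k\<close> is the gap around the scale of the pair: 0 for the upper bound,
    where the whole class takes part, and 4 for the lower bound, where level \<open>j\<close> is
    left out.\<close>
  have part: "\<bar>\<Sum>l\<in>A. \<rho> l * (\<phi> l t x - \<phi> l t y)\<bar> \<le> 2 * m * \<rho> j / s ^ k + 8 * m * d x y / \<rho> (j' + k)"
    if xy: "x \<in> M" "y \<in> M" and A: "finite A" "\<And>l. l \<in> A \<Longrightarrow> l + k \<le> j \<or> j' + k \<le> l" for x y t A k j j'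
  proof -
    let ?f = "\<lambda>l. \<bar>\<rho> l * (\<phi> l t x - \<phi> l t y)\<bar>"
    let ?lo = "{l \<in> A. l + k \<le> j}"
    have f_eq: "?f l = \<rho> l * \<bar>\<phi> l t x - \<phi> l t y\<bar>" for l using \<rho>_pos[of l] by (simp add: abs_mult)
    have "\<bar>\<Sum>l\<in>A. \<rho> l * (\<phi> l t x - \<phi> l t y)\<bar> \<le> (\<Sum>l\<in>A. ?f l)" by (rule sum_abs)
    also have "\<dots> = (\<Sum>l\<in>?lo. ?f l) + (\<Sum>l\<in>A - ?lo. ?f l)"
      by (subst sum.subset_diff[of ?lo A]) (use A(1) in auto)
    also have "(\<Sum>l\<in>?lo. ?f l) \<le> (\<Sum>l\<in>?lo. m * sqrt \<sigma> * s ^ l)"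
    proof (rule sum_mono)
      fix l
      have "\<rho> l * \<bar>\<phi> l t x - \<phi> l t y\<bar> \<le> \<rho> l * m" using \<rho>_pos[of l] \<phi>1 by (intro mult_left_mono) auto
      then show "?f l \<le> m * sqrt \<sigma> * s ^ l" unfolding f_eq by (simp add: \<rho>_def mult_ac)
    qed
    also have "\<dots> = m * sqrt \<sigma> * (\<Sum>l\<in>?lo. s ^ l)" by (simp add: sum_distrib_left)
    also have "\<dots> \<le> m * sqrt \<sigma> * (2 * s ^ j / s ^ k)"
    proof (rule mult_left_mono)
      have "(\<Sum>l\<in>?lo. s ^ l) * s ^ k \<le> 2 * s ^ j"
        by (rule sum_power_lower_le[OF s2]) (use A(1) in auto)
      then show "(\<Sum>l\<in>?lo. s ^ l) \<le> 2 * s ^ j / s ^ k" using s2 by (subst pos_le_divide_eq) auto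
    qed (use m \<sigma> in auto)
    also have "\<dots> = 2 * m * \<rho> j / s ^ k" by (simp add: \<rho>_def)
    also have "(\<Sum>l\<in>A - ?lo. ?f l) \<le> (\<Sum>l\<in>A - ?lo. 4 * m * d x y / sqrt \<sigma> * (1 / s ^ l))"
    proof (rule sum_mono)
      fix l
      have "\<rho> l * \<bar>\<phi> l t x - \<phi> l t y\<bar> \<le> \<rho> l * (4 * m * d x y / R l)"
        using \<rho>_pos[of l] \<phi>2[OF xy] by (intro mult_left_mono) auto
      also have "\<dots> = 4 * m * d x y / \<rho> l" using \<rho>_pos[of l] by (simp add: R_def power2_eq_square)
      finally show "?f l \<le> 4 * m * d x y / sqrt \<sigma> * (1 / s ^ l)"
        unfolding f_eq by (simp add: \<rho>_def)
    qed
    also have "\<dots> = 4 * m * d x y / sqrt \<sigma> * (\<Sum>l\<in>A - ?lo. 1 / s ^ l)" by (simp only: sum_distrib_left)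
    also have "\<dots> \<le> 4 * m * d x y / sqrt \<sigma> * (2 / s ^ (j' + k))"
    proof (rule mult_left_mono)
      show "(\<Sum>l\<in>A - ?lo. 1 / s ^ l) \<le> 2 / s ^ (j' + k)"
        by (rule sum_inverse_power_upper_le[OF s2]) (use A in auto)
    qed (use m \<sigma> in auto)
    also have "\<dots> = 8 * m * d x y / \<rho> (j' + k)" by (simp add: \<rho>_def)
    finally show ?thesis by simp
  qed
  show ?thesis
  proof (rule that[of F])
    fix x y i assume xy: "x \<in> M" "y \<in> M"
    show "(F x i - F y i)\<^sup>2 \<le> 144 * m\<^sup>2 * d x y"
    proof (cases "x = y")
      case False
      obtain j where j: "R j \<le> d x y" "d x y < R (Suc j)" using level[OF xy False] by blast
      have rj: "\<rho> j \<le> sqrt (d x y)" using j(1) by (simp add: R_def real_le_rsqrt)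
      have rj1: "sqrt (d x y) \<le> \<rho> (Suc j)"
        using j(2) \<rho>_pos[of "Suc j"] by (simp add: R_def real_le_lsqrt less_imp_le)
      have dpos: "0 < d x y" using R_pos[of j] j(1) by simp
      have "\<bar>F x i - F y i\<bar> \<le> 2 * m * \<rho> j / s ^ 0 + 8 * m * d x y / \<rho> (Suc j + 0)"
        unfolding diff by (rule part[OF xy finC]) auto
      also have "d x y / \<rho> (Suc j) \<le> sqrt (d x y)"
      proof -
        have "d x y = sqrt (d x y) * sqrt (d x y)" using dpos by simp
        also have "\<dots> \<le> sqrt (d x y) * \<rho> (Suc j)" using rj1 dpos by (intro mult_left_mono) auto
        finally show ?thesis using \<rho>_pos[of "Suc j"] by (simp add: pos_divide_le_eq)
      qed
      then have "8 * m * (d x y / \<rho> (Suc j)) \<le> 8 * m * sqrt (d x y)" using m by (intro mult_left_mono) auto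
      then have "2 * m * \<rho> j / s ^ 0 + 8 * m * d x y / \<rho> (Suc j + 0) \<le> 2 * m * \<rho> j + 8 * m * sqrt (d x y)"
        by simp
      also have "2 * m * \<rho> j \<le> 2 * m * sqrt (d x y)" using rj m by (intro mult_left_mono) auto
      finally have "\<bar>F x i - F y i\<bar> \<le> 10 * (m * sqrt (d x y))" by simp
      also have "\<dots> \<le> 12 * (m * sqrt (d x y))" using m dpos by (intro mult_right_mono) auto
      finally have "\<bar>F x i - F y i\<bar>\<^sup>2 \<le> (12 * (m * sqrt (d x y)))\<^sup>2" by (intro power_mono) auto
      then show ?thesis using dpos by (simp add: power_mult_distrib)
    qed (use m in simp)
  next
    fix x y assume xy: "x \<in> M" "y \<in> M" "x \<noteq> y"
    obtain j where j: "j < J" "R j \<le> d x y" "d x y < R (Suc j)" using level[OF xy] by blast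
    obtain t where t: "t < n" "1 / 4 \<le> \<bar>\<phi> j t x - \<phi> j t y\<bar>"
      using \<phi>3[OF xy(1,2) j(2)] j(3) R_Suc by auto
    define i where "i = 4 * t + j mod 4"
    have i: "i < 4 * n" "i div 4 = t" "i mod 4 = j mod 4" using t(1) by (auto simp: i_def)
    have jC: "j \<in> C i" using i j(1) by (simp add: C_def)
    have split: "F x i - F y i = \<rho> j * (\<phi> j t x - \<phi> j t y) + (\<Sum>l\<in>C i - {j}. \<rho> l * (\<phi> l t x - \<phi> l t y))"
      unfolding diff i(2) by (rule sum.remove[OF finC jC])
    have main: "\<rho> j / 4 \<le> \<bar>\<rho> j * (\<phi> j t x - \<phi> j t y)\<bar>"
      using mult_left_mono[OF t(2), of "\<rho> j"] \<rho>_pos[of j] by (simp add: abs_mult)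
    have rest: "\<bar>\<Sum>l\<in>C i - {j}. \<rho> l * (\<phi> l t x - \<phi> l t y)\<bar> \<le> 2 * m * \<rho> j / s ^ 4 + 8 * m * d x y / \<rho> (j + 4)"
    proof (rule part[OF xy(1,2)])
      fix l assume l: "l \<in> C i - {j}"
      then have lj: "l mod 4 = j mod 4" "l \<noteq> j" using i(3) unfolding C_def by simp_all
      have apart: "u + 4 \<le> v" if "u < v" "u mod 4 = v mod 4" for u v :: nat
      proof -
        have "4 dvd v - u" using that mod_eq_dvd_iff_nat[of u v 4] by simp
        from dvd_imp_le[OF this] that(1) show ?thesis by simp
      qed
      show "l + 4 \<le> j \<or> j + 4 \<le> l"
        using apart[of l j] apart[of j l] lj by (cases "l < j") auto
    qed (simp add: finC)
    have s4: "s\<^sup>2 \<le> s ^ 4" using s2 by (intro power_increasing) auto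
    have sp: "0 < s\<^sup>2" using s2 by simp
    have "2 * m * \<rho> j / s ^ 4 \<le> 2 * m * \<rho> j / s\<^sup>2"
      using s4 sp m \<rho>_pos[of j] by (intro divide_left_mono) auto
    \<comment> \<open>Why four classes: the distance is below
      \<open>\<rho> j * \<rho> j * s\<^sup>2\<close>, while
      \<open>\<rho> (j + 4) = \<rho> j * s ^ 4\<close>, which leaves a divisor
      \<open>s\<^sup>2\<close> to beat \<open>m\<close>. A gap of 3 would leave only
      \<open>s\<close>, which is of the order of the root of \<open>m\<close> when
      \<open>s\<^sup>2\<close> is comparable to \<open>m\<close>.\<close>
    moreover have "8 * m * d x y / \<rho> (j + 4) \<le> 8 * m * \<rho> j / s\<^sup>2"
    proof -
      have "8 * m * d x y / \<rho> (j + 4) \<le> 8 * m * R (Suc j) / \<rho> (j + 4)"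
        using j(3) m \<rho>_pos[of "j + 4"] by (intro divide_right_mono mult_left_mono) auto
      also have "\<dots> = 8 * m * \<rho> j / s\<^sup>2"
      proof -
        have "R (Suc j) = \<rho> j * \<rho> j * s\<^sup>2" "\<rho> (j + 4) = \<rho> j * s\<^sup>2 * s\<^sup>2"
          by (simp_all add: R_def \<rho>_def power_add power_mult_distrib power2_eq_square power4_eq_xxxx)
        then show ?thesis using \<rho>_pos[of j] sp by (simp add: field_simps)
      qed
      finally show ?thesis .
    qed
    moreover have "2 * m * \<rho> j / s\<^sup>2 + 8 * m * \<rho> j / s\<^sup>2 = 10 * (m / s\<^sup>2) * \<rho> j"
      by (simp add: field_simps)
    ultimately have "2 * m * \<rho> j / s ^ 4 + 8 * m * d x y / \<rho> (j + 4) \<le> 10 * (m / s\<^sup>2) * \<rho> j"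
      by linarith
    \<comment> \<open>The interference is at most 10/128 of \<open>\<rho> j\<close>, hence below
      1/8: at most half of the main term \<open>\<rho> j / 4\<close>.\<close>
    also have "\<dots> \<le> 10 * (1 / 128) * \<rho> j"
      using sm sp \<rho>_pos[of j] by (intro mult_right_mono mult_left_mono) (auto simp: field_simps)
    finally have "\<bar>\<Sum>l\<in>C i - {j}. \<rho> l * (\<phi> l t x - \<phi> l t y)\<bar> \<le> \<rho> j / 8"
      using rest \<rho>_pos[of j] by linarith
    then have "\<rho> j / 8 \<le> \<bar>F x i - F y i\<bar>" unfolding split using main by linarith
    then have "(\<rho> j / 8)\<^sup>2 \<le> \<bar>F x i - F y i\<bar>\<^sup>2" using \<rho>_pos[of j] by (intro power_mono) auto
    then have "R j \<le> 64 * (F x i - F y i)\<^sup>2" by (simp add: R_def power_divide)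
    then have "s\<^sup>2 * R j \<le> s\<^sup>2 * (64 * (F x i - F y i)\<^sup>2)" by (intro mult_left_mono) auto
    then have "d x y \<le> 64 * s\<^sup>2 * (F x i - F y i)\<^sup>2" using j(3) R_Suc[of j] by (simp add: mult_ac)
    then show "\<exists>i<4 * n. d x y \<le> 64 * s\<^sup>2 * (F x i - F y i)\<^sup>2" using i(1) by blast
  qed
qed

end

section \<open>Choice of the parameters\<close>

lemma one_minus_inverse_power_le_half:
  assumes "1 \<le> Q"
  shows "(1 - 1 / real Q) ^ Q \<le> 1 / 2"
proof -
  have "(1 - 1 / real Q) ^ Q \<le> exp (- (1 / real Q)) ^ Q"
    using assms exp_ge_add_one_self[of "- (1 / real Q)"] by (intro power_mono) auto
  also have "\<dots> = exp (- 1)" using assms by (simp flip: exp_of_nat_mult)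
  also have "\<dots> \<le> 1 / 2" using exp_ge_add_one_self[of 1] by (simp add: exp_minus field_simps)
  finally show ?thesis .
qed

text \<open>The product of the number \<open>400 a\<close> of coordinates, the weight \<open>64 * 256 m\<close> and the squared Hoelder constant
  \<open>144 m\<^sup>2\<close>, where \<open>m ^ 3 \<le> 2 ^ 48 * a ^ 4\<close>.\<close>

definition distortion_const :: real where
  "distortion_const = 400 * 64 * 256 * 144 * 2 ^ 48"

text \<open>Choosing \<open>g\<close> with \<open>64 ^ g \<le> a < 64 ^ (g + 1)\<close> makes all
  parameters powers of 2, with \<open>Q\<close> of order a^(1/6) and \<open>m\<close> of order
  a^(4/3). Base 64 is chosen because \<open>256 ^ g\<close> is then \<open>64 ^ g\<close> times two
  factors \<open>2 ^ g\<close>: one goes into \<open>Q\<close>, the other dominates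
  \<open>i\<close>, which is linear in \<open>g\<close>. One good coordinate suffices for the lower
  bound, so summing costs only the number of coordinates in the upper bound.\<close>

lemma (in Metric_space) doubling_snowflake_embedding:
  assumes fin: "finite M" and ne: "M \<noteq> {}" and dbl: "doubling M d K" and Ka: "K \<le> 2 ^ a" and a: "1 \<le> a"
  obtains F :: "'a \<Rightarrow> nat \<Rightarrow> real" and w :: real where "0 < w"
    "\<And>x y. x \<in> M \<Longrightarrow> y \<in> M \<Longrightarrow> d x y \<le> (\<Sum>i<400 * a. w * (F x i - F y i)\<^sup>2)"
    "\<And>x y. x \<in> M \<Longrightarrow> y \<in> M \<Longrightarrow>
      (\<Sum>i<400 * a. w * (F x i - F y i)\<^sup>2) \<le> distortion_const * real a ^ 5 * d x y"
proof -
  obtain g where g: "64 ^ g \<le> a" "a < 64 ^ (g + 1)" using ex_power_ivl1[of 64 a] a by auto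
  define \<mu> where "\<mu> = 4 * g + 8"
  define m :: nat where "m = 4 ^ \<mu>"
  define s :: real where "s = 16 * 2 ^ \<mu>"
  define Q :: nat where "Q = 2 ^ (g + 2)"
  \<comment> \<open>Then \<open>2 ^ i = 512 * s\<^sup>2 * m\<close>, the packing ratio for windows
    of relative length \<open>s\<^sup>2\<close>.\<close>
  define i where "i = 17 + 4 * \<mu>"
  \<comment> \<open>\<open>m = Q * h\<close>, so the tail \<open>(1 - 1 / Q) ^ m\<close> is at most
    \<open>(1 / 2) ^ h\<close>; \<open>h\<close> has to outweigh \<open>K ^ i\<close> and one factor
    \<open>Q\<close>.\<close>
  define h :: nat where "h = 2 ^ (7 * g + 14)"
  have m1: "1 \<le> m" by (simp add: m_def)
  have Q1: "1 \<le> Q" by (simp add: Q_def)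
  have two4: "(4::real) ^ \<mu> = 2 ^ \<mu> * 2 ^ \<mu>" by (simp flip: power_mult_distrib)
  have s_sq: "s\<^sup>2 = 256 * real m"
    unfolding s_def m_def by (simp add: power_mult_distrib two4 power2_eq_square)
  have i_eq: "512 * s\<^sup>2 * real m = 2 ^ i"
  proof -
    have "(2::real) ^ i = 2 ^ 17 * (2 ^ 4) ^ \<mu>" unfolding i_def power_add power_mult ..
    also have "(2 ^ 4 :: real) ^ \<mu> = 4 ^ \<mu> * 4 ^ \<mu>" by (simp flip: power_mult_distrib)
    finally show ?thesis unfolding s_sq m_def by simp
  qed
  have Ki: "K ^ i \<le> 2 ^ (a * i)" using power_mono[OF Ka, of i] by (simp add: power_mult)
  have gpow: "Suc g \<le> 2 ^ g" by (induction g) auto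
  have h_ge: "a * i + g + 2 \<le> h"
  proof -
    have hs: "h = 64 ^ (g + 1) * (256 * 2 ^ g)"
    proof -
      have "h = 2 ^ (6 * (g + 1)) * 2 ^ (g + 8)" unfolding h_def power_add[symmetric] by simp
      also have "(2::nat) ^ (6 * (g + 1)) = 64 ^ (g + 1)" unfolding power_mult by simp
      finally show ?thesis by (simp add: power_add mult_ac)
    qed
    have "a * i + g + 2 \<le> a * i + a * (g + 2)" using mult_le_mono1[OF a, of "g + 2"] by simp
    also have "\<dots> = a * (17 * g + 51)" by (simp add: i_def \<mu>_def algebra_simps)
    also have "\<dots> \<le> 64 ^ (g + 1) * (256 * 2 ^ g)"
      using g(2) gpow by (intro mult_mono) auto
    finally show ?thesis unfolding hs .
  qed
  have trunc: "real (K ^ i) * (1 - 1 / real Q) ^ m \<le> 1 / real Q"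
  proof -
    have "m = Q * h"
    proof -
      have "m = 2 ^ (2 * \<mu>)" by (simp add: m_def power_mult)
      also have "2 * \<mu> = (g + 2) + (7 * g + 14)" by (simp add: \<mu>_def)
      finally show ?thesis unfolding Q_def h_def power_add by simp
    qed
    then have "(1 - 1 / real Q) ^ m = ((1 - 1 / real Q) ^ Q) ^ h" by (simp add: power_mult)
    also have "\<dots> \<le> (1 / 2) ^ h"
      using one_minus_inverse_power_le_half[OF Q1] Q1 by (intro power_mono) auto
    finally have le: "(1 - 1 / real Q) ^ m \<le> (1 / 2) ^ h" .
    have "real (K ^ i) * (1 - 1 / real Q) ^ m \<le> 2 ^ (a * i) * (1 / 2) ^ h"
    proof (rule mult_mono)
      show "real (K ^ i) \<le> 2 ^ (a * i)" using Ki by (metis of_nat_le_iff of_nat_numeral of_nat_power)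
      show "0 \<le> (1 - 1 / real Q) ^ m" using Q1 by (intro zero_le_power) simp
    qed (use le in auto)
    also have "\<dots> \<le> 2 ^ (a * i) * (1 / 2) ^ (a * i + (g + 2))"
      using h_ge by (intro mult_left_mono power_decreasing) auto
    also have "\<dots> = (1 / 2) ^ (g + 2)" by (simp add: power_add power_one_over)
    also have "\<dots> = 1 / real Q" by (simp add: Q_def power_one_over)
    finally show ?thesis .
  qed
  have lll: "4 * (2 / real Q) ^ (100 * a) * real ((K ^ i)\<^sup>2) \<le> 1"
  proof -
    have Q2: "2 / real Q = (1 / 2) ^ (g + 1)" by (simp add: Q_def power_one_over)
    have "real ((K ^ i)\<^sup>2) \<le> real ((2 ^ (a * i))\<^sup>2)"
      unfolding of_nat_le_iff using Ki by (rule power_mono) simp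
    also have "\<dots> = 2 ^ (2 * (a * i))" by (simp add: power_mult[symmetric] mult.commute)
    finally have "4 * (2 / real Q) ^ (100 * a) * real ((K ^ i)\<^sup>2)
        \<le> 4 * (2 / real Q) ^ (100 * a) * 2 ^ (2 * (a * i))"
      by (intro mult_left_mono) auto
    also have "\<dots> = (1 / 2) ^ ((g + 1) * (100 * a)) * 2 ^ (2 + 2 * (a * i))"
      unfolding Q2 power_mult[symmetric] by (simp add: power_add)
    also have "\<dots> \<le> (1 / 2) ^ (2 + 2 * (a * i)) * 2 ^ (2 + 2 * (a * i))"
    proof (intro mult_right_mono power_decreasing)
      \<comment> \<open>The origin of the 100: \<open>2 * i = 32 * g + 98\<close>, and 2 more come
        from the factor 4 of the local lemma. The exponent \<open>g + 1\<close> of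
        \<open>2 / Q\<close> supplies the growth in \<open>g\<close>.\<close>
      have "2 + 2 * (a * i) = 2 + a * (32 * g + 98)" by (simp add: i_def \<mu>_def algebra_simps)
      also have "\<dots> \<le> a * 2 + a * (32 * g + 98)" using a by simp
      also have "\<dots> \<le> (g + 1) * (100 * a)" by (simp add: algebra_simps)
      finally show "2 + 2 * (a * i) \<le> (g + 1) * (100 * a)" .
    qed auto
    also have "\<dots> = 1" by (simp flip: power_mult_distrib)
    finally show ?thesis .
  qed
  have s2_1: "1 \<le> s\<^sup>2" unfolding s_sq using m1 by simp
  obtain F where F1: "\<And>x y l. x \<in> M \<Longrightarrow> y \<in> M \<Longrightarrow> (F x l - F y l)\<^sup>2 \<le> 144 * (real m)\<^sup>2 * d x y"
    and F2: "\<And>x y. x \<in> M \<Longrightarrow> y \<in> M \<Longrightarrow> x \<noteq> y \<Longrightarrow>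
      \<exists>l<4 * (100 * a). d x y \<le> 64 * s\<^sup>2 * (F x l - F y l)\<^sup>2"
  proof (rule multiscale_embedding[OF fin, of "real m" s "100 * a"])
    show "1 \<le> real m" using m1 by simp
    show "0 \<le> s" by (simp add: s_def)
    show "128 * real m \<le> s\<^sup>2" unfolding s_sq by simp
    fix r :: real assume r: "0 < r"
    obtain \<phi> :: "nat \<Rightarrow> 'a \<Rightarrow> real" where
      "\<And>t x y. \<bar>\<phi> t x - \<phi> t y\<bar> \<le> real m"
      "\<And>t x y. x \<in> M \<Longrightarrow> y \<in> M \<Longrightarrow> \<bar>\<phi> t x - \<phi> t y\<bar> \<le> 4 * real m * d x y / r"
      "\<And>x y. x \<in> M \<Longrightarrow> y \<in> M \<Longrightarrow> r \<le> d x y \<Longrightarrow> d x y < s\<^sup>2 * r \<Longrightarrow>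
        \<exists>t<100 * a. 1 / 4 \<le> \<bar>\<phi> t x - \<phi> t y\<bar>"
      using single_scale_map[OF fin ne dbl r m1 s2_1 Q1 _ trunc lll] i_eq by (metis order_refl)
    then show "\<exists>\<phi>::nat \<Rightarrow> 'a \<Rightarrow> real. (\<forall>t x y. \<bar>\<phi> t x - \<phi> t y\<bar> \<le> real m) \<and>
      (\<forall>t. \<forall>x\<in>M. \<forall>y\<in>M. \<bar>\<phi> t x - \<phi> t y\<bar> \<le> 4 * real m * d x y / r) \<and>
      (\<forall>x\<in>M. \<forall>y\<in>M. r \<le> d x y \<longrightarrow> d x y < s\<^sup>2 * r \<longrightarrow> (\<exists>t<100 * a. 1 / 4 \<le> \<bar>\<phi> t x - \<phi> t y\<bar>))"
      by (intro exI[of _ \<phi>]) simp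
  qed (rule that)
  let ?w = "64 * s\<^sup>2"
  have w0: "0 < ?w" using s2_1 by linarith
  show ?thesis
  proof (rule that[OF w0, of F])
    fix x y assume xy: "x \<in> M" "y \<in> M"
    show "d x y \<le> (\<Sum>l<400 * a. ?w * (F x l - F y l)\<^sup>2)"
    proof (cases "x = y")
      case False
      obtain l where l: "l < 400 * a" "d x y \<le> ?w * (F x l - F y l)\<^sup>2" using F2[OF xy False] by auto
      have "?w * (F x l - F y l)\<^sup>2 \<le> (\<Sum>l<400 * a. ?w * (F x l - F y l)\<^sup>2)"
        using l(1) by (intro member_le_sum) auto
      with l(2) show ?thesis by linarith
    qed (use xy in simp)
    have "(\<Sum>l<400 * a. ?w * (F x l - F y l)\<^sup>2) \<le> (\<Sum>l<400 * a. ?w * (144 * (real m)\<^sup>2 * d x y))"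
      using F1[OF xy] w0 by (intro sum_mono mult_left_mono) auto
    also have "\<dots> = 400 * 64 * 256 * 144 * (real m ^ 3) * real a * d x y"
      unfolding s_sq by (simp add: power2_eq_square power3_eq_cube)
    also have "real m ^ 3 = 2 ^ 48 * ((64::real) ^ g) ^ 4"
    proof -
      have "real m ^ 3 = (4 ^ \<mu>) ^ 3" by (simp add: m_def)
      also have "\<dots> = 2 ^ (48 + 6 * g * 4)"
      proof -
        have "(4::real) = 2 ^ 2" by simp
        then have "((4::real) ^ \<mu>) ^ 3 = 2 ^ (2 * \<mu> * 3)" by (simp only: power_mult)
        also have "2 * \<mu> * 3 = 48 + 6 * g * 4" by (simp add: \<mu>_def)
        finally show ?thesis .
      qed
      also have "\<dots> = 2 ^ 48 * ((2 ^ 6) ^ g) ^ 4" by (simp only: power_add power_mult)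
      finally show ?thesis by simp
    qed
    also have "400 * 64 * 256 * 144 * (2 ^ 48 * ((64::real) ^ g) ^ 4) * real a * d x y
        = distortion_const * (((64::real) ^ g) ^ 4 * (real a * d x y))"
      unfolding distortion_const_def by (simp only: mult.assoc)
    also have "\<dots> \<le> distortion_const * (real a ^ 4 * (real a * d x y))"
    proof (intro mult_left_mono mult_right_mono power_mono)
      show "(64::real) ^ g \<le> real a" using g(1) by (metis of_nat_le_iff of_nat_numeral of_nat_power)
    qed (auto simp: distortion_const_def)
    also have "\<dots> = distortion_const * real a ^ 5 * d x y"
    proof -
      have "real a ^ 5 = real a ^ 4 * real a" by (simp add: eval_nat_numeral)
      then show ?thesis by (simp only: mult.assoc)
    qed
    finally show "(\<Sum>l<400 * a. ?w * (F x l - F y l)\<^sup>2) \<le> distortion_const * real a ^ 5 * d x y" .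
  qed
qed

section \<open>Exact representation of finite metrics\<close>

text \<open>Banach's fixed point theorem in a cube, with the sup distance expressed by uniform
  bounds \<open>e\<close>. The iterates from the corner \<open>lo\<close> converge at a rate
  independent of the coordinate, which is what allows \<open>contr\<close> to compare them with the
  limit.\<close>

lemma sup_norm_contraction_fixpoint:
  fixes T :: "('i \<Rightarrow> real) \<Rightarrow> 'i \<Rightarrow> real"
  assumes lohi: "lo \<le> hi"
    and maps: "\<And>A. (\<And>i. A i \<in> {lo..hi}) \<Longrightarrow> (\<And>i. T A i \<in> {lo..hi})"
    and contr: "\<And>A B e i. (\<And>i. A i \<in> {lo..hi}) \<Longrightarrow> (\<And>i. B i \<in> {lo..hi}) \<Longrightarrow>
      (\<And>i. \<bar>A i - B i\<bar> \<le> e) \<Longrightarrow> \<bar>T A i - T B i\<bar> \<le> e / 2"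
  obtains A where "\<And>i. A i \<in> {lo..hi}" "T A = A"
proof -
  define X where "X n = (T ^^ n) (\<lambda>_. lo)" for n
  have X_Suc: "X (Suc n) = T (X n)" for n by (simp add: X_def)
  have box: "X n i \<in> {lo..hi}" for n i
  proof (induction n arbitrary: i)
    case (Suc n)
    show ?case unfolding X_Suc by (rule maps) (rule Suc)
  qed (use lohi in \<open>simp add: X_def\<close>)
  have close: "\<bar>X (n + k) i - X n i\<bar> \<le> (hi - lo) / 2 ^ n" for n k i
  proof (induction n arbitrary: i)
    case 0
    show ?case using box[of k i] box[of 0 i] by auto
  next
    case (Suc n)
    have "\<bar>T (X (n + k)) i - T (X n) i\<bar> \<le> (hi - lo) / 2 ^ n / 2"
      by (rule contr) (use box Suc in auto)
    then show ?case by (simp add: X_Suc mult.commute)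
  qed
  have lim0: "(\<lambda>n. (hi - lo) / 2 ^ n) \<longlonglongrightarrow> 0"
    using tendsto_mult[OF tendsto_const[of "hi - lo"] LIMSEQ_power_zero[of "1 / 2 :: real"]]
    by (simp add: power_divide)
  have "Cauchy (\<lambda>n. X n i)" for i
  proof (rule metric_CauchyI)
    fix e :: real assume "0 < e"
    then obtain n where n: "(hi - lo) / 2 ^ n < e / 2"
      using order_tendstoD(2)[OF lim0, of "e / 2"] by (auto simp: eventually_sequentially)
    have near: "\<bar>X p i - X n i\<bar> \<le> (hi - lo) / 2 ^ n" if "n \<le> p" for p
      using close[of n "p - n" i] that by simp
    have "dist (X p i) (X q i) < e" if "n \<le> p" "n \<le> q" for p q
      using near[OF that(1)] near[OF that(2)] n unfolding dist_real_def by linarith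
    then show "\<exists>n. \<forall>p\<ge>n. \<forall>q\<ge>n. dist (X p i) (X q i) < e" by blast
  qed
  then have "\<forall>i. \<exists>l. (\<lambda>n. X n i) \<longlonglongrightarrow> l" using real_Cauchy_convergent convergent_def by blast
  then obtain A where A: "\<And>i. (\<lambda>n. X n i) \<longlonglongrightarrow> A i" by metis
  have Abox: "A i \<in> {lo..hi}" for i
    using box by (intro closed_sequentially[OF closed_atLeastAtMost _ A]) blast
  have close': "\<bar>A i - X n i\<bar> \<le> (hi - lo) / 2 ^ n" for n i
  proof (rule LIMSEQ_le_const2)
    show "(\<lambda>k. \<bar>X (n + k) i - X n i\<bar>) \<longlonglongrightarrow> \<bar>A i - X n i\<bar>"
      using LIMSEQ_ignore_initial_segment[OF A[of i], of n]
      by (intro tendsto_intros) (simp add: add.commute)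
  qed (use close in blast)
  have "T A i = A i" for i
  proof (rule LIMSEQ_unique)
    show "(\<lambda>n. X (Suc n) i) \<longlonglongrightarrow> A i" by (rule LIMSEQ_Suc[OF A])
    have "(\<lambda>n. X (Suc n) i - T A i) \<longlonglongrightarrow> 0"
    proof (rule Lim_null_comparison[OF _ lim0], rule eventuallyI)
      fix n
      have "\<bar>T (X n) i - T A i\<bar> \<le> (hi - lo) / 2 ^ n / 2"
        by (rule contr) (use box Abox close' abs_minus_commute in \<open>auto simp: abs_minus_commute\<close>)
      also have "\<dots> \<le> (hi - lo) / 2 ^ n" using lohi by (simp add: field_simps)
      finally show "norm (X (Suc n) i - T A i) \<le> (hi - lo) / 2 ^ n" by (simp add: X_Suc)
    qed
    then show "(\<lambda>n. X (Suc n) i) \<longlonglongrightarrow> T A i" by (simp add: LIM_zero_iff)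
  qed
  then show ?thesis using Abox that by blast
qed

text \<open>Doubling the arguments moves them into the unit interval, where the power is
  \<open>p\<close>-Lipschitz. Undoing this leaves a constant that is exponentially small in
  \<open>p\<close>.\<close>

lemma abs_power_diff_half:
  fixes x y :: real
  assumes "\<bar>x\<bar> \<le> 1 / 2" "\<bar>y\<bar> \<le> 1 / 2"
  shows "\<bar>\<bar>x\<bar> ^ p - \<bar>y\<bar> ^ p\<bar> \<le> 2 * real p * \<bar>x - y\<bar> / 2 ^ p"
proof -
  have "\<bar>(2 * \<bar>x\<bar>) ^ p - (2 * \<bar>y\<bar>) ^ p\<bar> \<le> real p * \<bar>2 * \<bar>x\<bar> - 2 * \<bar>y\<bar>\<bar>"
    using norm_power_diff[of "2 * \<bar>x\<bar>" "2 * \<bar>y\<bar>" p] assms by simp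
  also have "\<bar>2 * \<bar>x\<bar> - 2 * \<bar>y\<bar>\<bar> = 2 * \<bar>\<bar>x\<bar> - \<bar>y\<bar>\<bar>"
    by (simp only: right_diff_distrib[symmetric] abs_mult abs_numeral)
  also have "real p * (2 * \<bar>\<bar>x\<bar> - \<bar>y\<bar>\<bar>) \<le> real p * (2 * \<bar>x - y\<bar>)"
    by (intro mult_left_mono abs_triangle_ineq3) auto
  finally have "2 ^ p * \<bar>\<bar>x\<bar> ^ p - \<bar>y\<bar> ^ p\<bar> \<le> 2 * real p * \<bar>x - y\<bar>"
    by (simp add: power_mult_distrib right_diff_distrib[symmetric] abs_mult)
  then show ?thesis by (simp add: field_simps)
qed

text \<open>For \<open>y \<le> x\<close> the difference of powers is at least
  \<open>x ^ (p - 1) * (x - y)\<close>, and \<open>x ^ (p - 1) \<ge> x ^ p \<ge> c\<close>. In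
  effect, \<open>p\<close>-th roots of numbers between \<open>c > 0\<close> and 1 are Lipschitz with
  constant \<open>1 / c\<close>, uniformly in \<open>p\<close>.\<close>

lemma power_diff_lower_bound:
  fixes x y c :: real
  assumes "0 \<le> x" "x \<le> 1" "0 \<le> y" "y \<le> 1" "c \<le> x ^ p" "c \<le> y ^ p" "0 < p"
  shows "c * \<bar>x - y\<bar> \<le> \<bar>x ^ p - y ^ p\<bar>"
proof -
  have *: "c * (x - y) \<le> x ^ p - y ^ p" if "y \<le> x" "0 \<le> y" "x \<le> 1" "c \<le> x ^ p" for x y :: real
  proof -
    obtain q where q: "p = Suc q" using \<open>0 < p\<close> gr0_implies_Suc by blast
    have "x ^ p \<le> x ^ q" unfolding q using that by (simp add: mult_left_le_one_le)
    then have "c * (x - y) \<le> x ^ q * (x - y)" using that by (intro mult_right_mono) auto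
    also have "\<dots> = x ^ p - x ^ q * y" unfolding q by (simp add: algebra_simps)
    also have "\<dots> \<le> x ^ p - y ^ q * y" using that by (intro diff_left_mono mult_right_mono power_mono) auto
    finally show ?thesis by (simp add: q mult.commute)
  qed
  show ?thesis
  proof (cases "y \<le> x")
    case True
    then show ?thesis using *[of y x] assms by simp
  next
    case False
    then show ?thesis using *[of x y] assms by simp
  qed
qed

text \<open>For large \<open>p\<close>, a coordinate in which point \<open>l\<close> sits at 0, the earlier points at \<open>1/2\<close> and the later
  points near 1 contributes almost only to the pairs \<open>(l, j)\<close> with \<open>l < j\<close>. The unknown positions near 1
  can therefore be adjusted, pair by pair, by a contraction.\<close>

lemma exact_power_representation:
  fixes \<delta> :: "nat \<Rightarrow> nat \<Rightarrow> real" and k :: nat and \<eta> :: real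
  assumes \<eta>: "0 < \<eta>" and sym: "\<And>i j. \<delta> i j = \<delta> j i" and diag: "\<And>i. i < k \<Longrightarrow> \<delta> i i = 0"
    and lower: "\<And>i j. i < k \<Longrightarrow> j < k \<Longrightarrow> i \<noteq> j \<Longrightarrow> \<eta> \<le> \<delta> i j"
    and upper: "\<And>i j. i < k \<Longrightarrow> j < k \<Longrightarrow> \<delta> i j \<le> 1"
  obtains p :: nat and a :: "nat \<Rightarrow> nat \<Rightarrow> real" where "0 < p"
    "\<And>i j. i < k \<Longrightarrow> j < k \<Longrightarrow> \<delta> i j = (\<Sum>l<k. \<bar>a l i - a l j\<bar> ^ p)"
proof -
  \<comment> \<open>Three demands on \<open>p\<close>: roots of numbers between
    \<open>\<eta> / 2\<close> and 1 lie between 3/4 and 1; errors stay below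
    \<open>\<eta> / 2\<close>; and errors depend on the unknowns with Lipschitz constant at most
    \<open>\<eta> / 4\<close>, which the root, with constant \<open>2 / \<eta>\<close>, turns into
    1/2.\<close>
  have "\<forall>\<^sub>F p in sequentially. (3 / 4 :: real) ^ p < \<eta> / 2"
    using order_tendstoD(2)[OF LIMSEQ_power_zero[of "3 / 4 :: real"], of "\<eta> / 2"] \<eta> by simp
  moreover have "\<forall>\<^sub>F p in sequentially. real k * (1 / 2) ^ p < \<eta> / 2"
    using order_tendstoD(2)[OF tendsto_mult[OF tendsto_const[of "real k"] LIMSEQ_power_zero[of "1 / 2 :: real"]], of "\<eta> / 2"] \<eta>
    by simp
  moreover have "\<forall>\<^sub>F p in sequentially. real k * (real p * (1 / 2) ^ p) < \<eta> / 16"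
    using order_tendstoD(2)[OF tendsto_mult[OF tendsto_const[of "real k"] powser_times_n_limit_0[of "1 / 2 :: real"]], of "\<eta> / 16"] \<eta>
    by simp
  moreover have "\<forall>\<^sub>F p in sequentially. (0::nat) < p" by (rule eventually_gt_at_top)
  ultimately have "\<forall>\<^sub>F p in sequentially. (3 / 4 :: real) ^ p < \<eta> / 2 \<and> real k * (1 / 2) ^ p < \<eta> / 2
      \<and> real k * (real p * (1 / 2) ^ p) < \<eta> / 16 \<and> 0 < p" by eventually_elim simp
  then obtain p :: nat where p: "(3 / 4 :: real) ^ p < \<eta> / 2" "real k * (1 / 2) ^ p < \<eta> / 2"
    "real k * (real p * (1 / 2) ^ p) < \<eta> / 16" "0 < p"
    by (auto simp: eventually_sequentially)
  define a where "a A l i = (if i = l then 0 else if i < l then 1 / 2 else A (l, i))"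
    for A :: "nat \<times> nat \<Rightarrow> real" and l i :: nat
  define err where "err A i j = (\<Sum>l\<in>{..<k} - {i}. \<bar>a A l i - a A l j\<bar> ^ p)" for A i j
  \<comment> \<open>Solves the equation of the pair \<open>(i, j)\<close> for its own unknown with
    the error frozen. The default 1 lies in the box and is trivially contracting.\<close>
  define T where "T A = (\<lambda>(i, j). if i < j \<and> j < k then root p (\<delta> i j - err A i j) else 1)" for A
  \<comment> \<open>Only coordinate \<open>i\<close> puts one point of the pair at 0 and the other
    near 1. For \<open>l \<noteq> i\<close> both are near 1, or both at 1/2, or one is at 1/2 and
    the other near 1, or, when \<open>l = j\<close>, at 0.\<close>
  have half: "\<bar>a A l i - a A l j\<bar> \<le> 1 / 2" if A: "\<And>i. A i \<in> {3/4..1}" and "i < j" "l \<noteq> i" for A l i j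
    using A[of "(l, i)"] A[of "(l, j)"] that(2,3) unfolding abs_le_iff a_def by auto
  have err0: "0 \<le> err A i j" for A i j unfolding err_def by (intro sum_nonneg) auto
  have err_le: "err A i j \<le> \<eta> / 2" if A: "\<And>i. A i \<in> {3/4..1}" and "i < j" for A i j
  proof -
    have "err A i j \<le> real (card ({..<k} - {i})) * (1 / 2) ^ p"
      unfolding err_def by (rule sum_bounded_above) (use half[OF A] that in \<open>auto intro!: power_mono\<close>)
    also have "\<dots> \<le> real k * (1 / 2) ^ p"
      using card_mono[of "{..<k}" "{..<k} - {i}"] by (intro mult_right_mono) auto
    finally show ?thesis using p(2) by simp
  qed
  have arg: "\<eta> / 2 \<le> \<delta> i j - err A i j" "\<delta> i j - err A i j \<le> 1"
    if A: "\<And>i. A i \<in> {3/4..1}" and "i < j" "j < k" for A i j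
  proof -
    have "err A i j \<le> \<eta> / 2" using A \<open>i < j\<close> by (rule err_le)
    moreover have "\<eta> \<le> \<delta> i j" "\<delta> i j \<le> 1" using lower[of i j] upper[of i j] that(2,3) by auto
    ultimately show "\<eta> / 2 \<le> \<delta> i j - err A i j" "\<delta> i j - err A i j \<le> 1"
      using err0[of A i j] by linarith+
  qed
  have root_box: "root p z \<in> {3/4..1}" if "\<eta> / 2 \<le> z" "z \<le> 1" for z
  proof -
    have "root p ((3 / 4) ^ p) \<le> root p z" using p that by (subst real_root_le_iff) auto
    moreover have "root p z \<le> root p 1" using p that by (subst real_root_le_iff) auto
    ultimately show ?thesis using p by (simp add: real_root_power_cancel)
  qed
  have root_pow: "root p z ^ p = z" if "\<eta> / 2 \<le> z" for z
    using that p \<eta> by (intro real_root_pow_pos2) auto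
  have maps: "T A i \<in> {3/4..1}" if A: "\<And>i. A i \<in> {3/4..1}" for A i
  proof (cases "fst i < snd i \<and> snd i < k")
    case True
    then have "T A i = root p (\<delta> (fst i) (snd i) - err A (fst i) (snd i))"
      by (simp add: T_def case_prod_unfold)
    then show ?thesis using root_box[OF arg[of A "fst i" "snd i"]] A True by simp
  qed (auto simp: T_def case_prod_unfold)
  have contr: "\<bar>T A ij - T B ij\<bar> \<le> e / 2"
    if A: "\<And>i. A i \<in> {3/4..1}" and B: "\<And>i. B i \<in> {3/4..1}" and e: "\<And>i. \<bar>A i - B i\<bar> \<le> e" for A B e ij
  proof -
    have e0: "0 \<le> e" using e[of undefined] by linarith
    obtain i j where ij: "ij = (i, j)" by (cases ij)
    show ?thesis
    proof (cases "i < j \<and> j < k")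
      case True
      have ae: "\<bar>a A l i' - a B l i'\<bar> \<le> e" for l i' using e[of "(l, i')"] e0 by (simp add: a_def)
      have "\<bar>err A i j - err B i j\<bar>
          \<le> (\<Sum>l\<in>{..<k} - {i}. \<bar>\<bar>a A l i - a A l j\<bar> ^ p - \<bar>a B l i - a B l j\<bar> ^ p\<bar>)"
        unfolding err_def sum_subtractf[symmetric] by (rule sum_abs)
      also have "\<dots> \<le> real (card ({..<k} - {i})) * (4 * real p * e / 2 ^ p)"
      proof (rule sum_bounded_above)
        fix l assume l: "l \<in> {..<k} - {i}"
        have "\<bar>\<bar>a A l i - a A l j\<bar> ^ p - \<bar>a B l i - a B l j\<bar> ^ p\<bar>
            \<le> 2 * real p * \<bar>(a A l i - a A l j) - (a B l i - a B l j)\<bar> / 2 ^ p"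
          using half[OF A] half[OF B] True l by (intro abs_power_diff_half) auto
        also have "\<bar>(a A l i - a A l j) - (a B l i - a B l j)\<bar> \<le> 2 * e"
          using ae[of l i] ae[of l j] by linarith
        then have "2 * real p * \<bar>(a A l i - a A l j) - (a B l i - a B l j)\<bar> / 2 ^ p
            \<le> 2 * real p * (2 * e) / 2 ^ p"
          by (intro divide_right_mono mult_left_mono) auto
        finally show "\<bar>\<bar>a A l i - a A l j\<bar> ^ p - \<bar>a B l i - a B l j\<bar> ^ p\<bar> \<le> 4 * real p * e / 2 ^ p"
          by simp
      qed
      also have "\<dots> \<le> real k * (4 * real p * e / 2 ^ p)"
        using card_mono[of "{..<k}" "{..<k} - {i}"] e0 by (intro mult_right_mono) auto
      also have "\<dots> = 4 * e * (real k * (real p * (1 / 2) ^ p))" by (simp add: power_divide)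
      also have "\<dots> \<le> 4 * e * (\<eta> / 16)" using p(3) e0 by (intro mult_left_mono) auto
      finally have errd: "\<bar>err A i j - err B i j\<bar> \<le> \<eta> / 4 * e" by simp
      let ?x = "\<delta> i j - err A i j" and ?y = "\<delta> i j - err B i j"
      have xy: "\<eta> / 2 \<le> ?x" "?x \<le> 1" "\<eta> / 2 \<le> ?y" "?y \<le> 1" using arg[of A i j] arg[of B i j] A B True by auto
      have "\<eta> / 2 * \<bar>root p ?x - root p ?y\<bar> \<le> \<bar>root p ?x ^ p - root p ?y ^ p\<bar>"
        using root_box[OF xy(1,2)] root_box[OF xy(3,4)] xy p(4) \<eta>
        by (intro power_diff_lower_bound) (auto simp: root_pow)
      also have "\<dots> = \<bar>err A i j - err B i j\<bar>" using xy by (simp add: root_pow abs_minus_commute)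
      finally have "\<eta> / 2 * \<bar>root p ?x - root p ?y\<bar> \<le> \<eta> / 2 * (e / 2)" using errd by simp
      then have "\<bar>root p ?x - root p ?y\<bar> \<le> e / 2" using \<eta> by simp
      then show ?thesis using True by (simp add: ij T_def)
    qed (use e0 in \<open>auto simp: ij T_def\<close>)
  qed
  obtain A where A: "\<And>i. A i \<in> {3/4..1}" and fp: "T A = A"
    by (rule sup_norm_contraction_fixpoint[of "3/4" 1 T]) (use maps contr in auto)
  have lt: "\<delta> i j = (\<Sum>l<k. \<bar>a A l i - a A l j\<bar> ^ p)" if ij: "i < j" "j < k" for i j
  proof -
    have "A (i, j) = root p (\<delta> i j - err A i j)" using fun_cong[OF fp, of "(i, j)"] ij by (simp add: T_def)
    then have "A (i, j) ^ p = \<delta> i j - err A i j" using root_pow[OF arg(1)[OF A ij]] by simp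
    moreover have "\<bar>a A i i - a A i j\<bar> = A (i, j)" using A[of "(i, j)"] ij by (simp add: a_def)
    moreover have "(\<Sum>l<k. \<bar>a A l i - a A l j\<bar> ^ p) = \<bar>a A i i - a A i j\<bar> ^ p + err A i j"
      unfolding err_def using ij by (intro sum.remove) auto
    ultimately show ?thesis by simp
  qed
  show ?thesis
  proof (rule that[OF p(4), of "a A"])
    fix i j assume ij: "i < k" "j < k"
    consider "i < j" | "i = j" | "j < i" by linarith
    then show "\<delta> i j = (\<Sum>l<k. \<bar>a A l i - a A l j\<bar> ^ p)"
    proof cases
      case 3
      then show ?thesis using lt[of j i] ij sym[of i j] by (simp add: abs_minus_commute)
    qed (use lt ij diag p in auto)
  qed
qed

text \<open>Dividing by \<open>w\<close> puts the distances of distinct points between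
  \<open>\<sigma> / w\<close> and 1; the weight then restores the scale.\<close>

lemma (in Metric_space) exact_power_embedding:
  assumes fin: "finite M"
  obtains p :: nat and w :: real and F :: "'a \<Rightarrow> nat \<Rightarrow> real" where "0 < p" "0 < w"
    "\<And>x y. x \<in> M \<Longrightarrow> y \<in> M \<Longrightarrow> d x y = (\<Sum>i<card M. w * \<bar>F x i - F y i\<bar> ^ p)"
proof -
  let ?S = "(\<lambda>(x, y). d x y) ` {(x, y) \<in> M \<times> M. x \<noteq> y}"
  have "finite {(x, y) \<in> M \<times> M. x \<noteq> y}"
    by (rule finite_subset[of _ "M \<times> M"]) (use fin in auto)
  then have finS: "finite ?S" by (rule finite_imageI)
  define \<sigma> where "\<sigma> = Min (insert 1 ?S)"
  define w where "w = Max (insert 1 ?S)"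
  have S_pos: "0 < z" if z: "z \<in> ?S" for z
  proof -
    obtain x y where xy: "x \<in> M" "y \<in> M" "x \<noteq> y" "z = d x y" using z by auto
    then show ?thesis using nonneg[of x y] zero[OF xy(1,2)] by linarith
  qed
  have \<sigma>: "0 < \<sigma>" unfolding \<sigma>_def using finS S_pos by (subst Min_gr_iff) auto
  have w: "0 < w" unfolding w_def using finS by (subst Max_gr_iff) auto
  have \<sigma>_le: "\<sigma> \<le> d x y" if "x \<in> M" "y \<in> M" "x \<noteq> y" for x y
    unfolding \<sigma>_def by (rule Min_le) (use finS that in auto)
  have w_ge: "d x y \<le> w" if "x \<in> M" "y \<in> M" for x y
  proof (cases "x = y")
    case False
    then show ?thesis unfolding w_def by (intro Max_ge) (use finS that in auto)
  qed (use that w in simp)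
  obtain h where h: "bij_betw h {0..<card M} M" using ex_bij_betw_nat_finite[OF fin] by blast
  have hM: "h i \<in> M" if "i < card M" for i using bij_betw_apply[OF h] that by simp
  have hinj: "h i \<noteq> h j" if "i < card M" "j < card M" "i \<noteq> j" for i j
    using bij_betw_imp_inj_on[OF h] that by (auto dest: inj_onD)
  define \<delta> where "\<delta> i j = d (h i) (h j) / w" for i j
  obtain p and a :: "nat \<Rightarrow> nat \<Rightarrow> real" where p: "0 < p"
    and a: "\<And>i j. i < card M \<Longrightarrow> j < card M \<Longrightarrow> \<delta> i j = (\<Sum>l<card M. \<bar>a l i - a l j\<bar> ^ p)"
  proof (rule exact_power_representation[of "\<sigma> / w" \<delta> "card M"])
    show "0 < \<sigma> / w" using \<sigma> w by simp
    show "\<delta> i j = \<delta> j i" for i j by (simp add: \<delta>_def commute)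
    show "\<delta> i i = 0" if "i < card M" for i using hM[OF that] by (simp add: \<delta>_def)
    show "\<sigma> / w \<le> \<delta> i j" if "i < card M" "j < card M" "i \<noteq> j" for i j
      using \<sigma>_le[OF hM hM hinj] that w by (simp add: \<delta>_def divide_right_mono)
    show "\<delta> i j \<le> 1" if "i < card M" "j < card M" for i j
      using w_ge[OF hM hM] that w by (simp add: \<delta>_def)
  qed (rule that)
  define g where "g = the_inv_into {0..<card M} h"
  have g: "g x < card M" "h (g x) = x" if "x \<in> M" for x
    using bij_betw_apply[OF bij_betw_the_inv_into[OF h] that] f_the_inv_into_f_bij_betw[OF h] that
    by (auto simp: g_def)
  show ?thesis
  proof (rule that[OF p w, of "\<lambda>x l. a l (g x)"])
    fix x y assume xy: "x \<in> M" "y \<in> M"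
    have "d x y / w = (\<Sum>i<card M. \<bar>a i (g x) - a i (g y)\<bar> ^ p)"
      using a[OF g(1)[OF xy(1)] g(1)[OF xy(2)]] xy by (simp add: \<delta>_def g(2))
    then have "d x y = w * (\<Sum>i<card M. \<bar>a i (g x) - a i (g y)\<bar> ^ p)" using w by (simp add: field_simps)
    then show "d x y = (\<Sum>i<card M. w * \<bar>a i (g x) - a i (g y)\<bar> ^ p)" by (simp add: sum_distrib_left)
  qed
qed

section \<open>Order embedding\<close>

text \<open>Galvin's induction. Remove a maximal element \<open>a\<close> and split the rest into
  \<open>w'\<close> chains, its own width. In each chain take the top element among those lying in
  antichains of size \<open>w'\<close>; these tops form an antichain. If \<open>a\<close> is above
  none of them, adding it gives a larger antichain, so a new chain for \<open>a\<close> is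
  affordable. Otherwise \<open>a\<close> caps the lower part of a chain whose removal decreases the
  width. Chains are the colour classes of \<open>c\<close>, and \<open>w\<close> is any bound on
  antichains.\<close>

lemma dilworth:
  fixes le :: "'a rel"
  assumes "finite P" and "refl_on P le" and tr: "trans le" and anti: "antisym le"
    and "\<And>S. antichain P le S \<Longrightarrow> card S \<le> w"
  shows "\<exists>c::'a \<Rightarrow> nat. (\<forall>x\<in>P. c x < w) \<and>
    (\<forall>x\<in>P. \<forall>y\<in>P. c x = c y \<longrightarrow> (x, y) \<in> le \<or> (y, x) \<in> le)"
  using assms(1,2,5)
proof (induction "card P" arbitrary: P w rule: less_induct)
  case less
  show ?case
  proof (cases "P = {}")
    case False
    obtain a where a: "a \<in> P" and amax: "\<And>x. x \<in> P \<Longrightarrow> (a, x) \<in> le \<Longrightarrow> x = a"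
    proof -
      \<comment> \<open>The strict order is reversed, so minimality for \<open>?r\<close> is
        maximality in \<open>P\<close>.\<close>
      let ?r = "{(y, x). x \<in> P \<and> y \<in> P \<and> (x, y) \<in> le \<and> x \<noteq> y}"
      have "?r \<subseteq> P \<times> P" by auto
      then have "finite ?r" using less.prems(1) finite_subset by blast
      moreover have "acyclic ?r"
      proof -
        have "trans ?r" using tr anti by (auto simp: trans_def antisym_def)
        then show ?thesis by (auto simp: acyclic_def trancl_id)
      qed
      ultimately have wf: "wf ?r" by (rule finite_acyclic_wf)
      obtain b where b: "b \<in> P" using False by blast
      have "\<exists>z\<in>P. \<forall>y. (y, z) \<in> ?r \<longrightarrow> y \<notin> P"
        by (rule wf[unfolded wf_eq_minimal, rule_format, OF b])
      then obtain z where z: "z \<in> P" "\<forall>y. (y, z) \<in> ?r \<longrightarrow> y \<notin> P" by (elim bexE) (rule that)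
      show ?thesis
      proof (rule that[OF z(1)], rule ccontr)
        fix x assume x: "x \<in> P" "(z, x) \<in> le" "x \<noteq> z"
        then have "(x, z) \<in> ?r" using z(1) by simp
        then show False using z(2) x(1) by blast
      qed
    qed
    let ?P = "P - {a}"
    have fin': "finite ?P" using less.prems by simp
    have refl': "refl_on Q le" if "Q \<subseteq> P" for Q
      using that less.prems(2) by (auto simp: refl_on_def)
    let ?c = "card ` {S. antichain ?P le S}"
    have "finite {S. antichain ?P le S}"
      by (rule finite_subset[of _ "Pow ?P"]) (use fin' in \<open>auto simp: antichain_def\<close>)
    then have fc: "finite ?c" by simp
    have "antichain ?P le {}" by (simp add: antichain_def)
    then have "?c \<noteq> {}" by blast
    from Max_in[OF fc this] obtain S0 where S0: "antichain ?P le S0" "card S0 = Max ?c" by auto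
    define w' where "w' = card S0"
    have w'max: "card S \<le> w'" if "antichain ?P le S" for S
      unfolding w'_def S0(2) using fc that by (intro Max_ge) auto
    have mono: "antichain P le S" if "antichain ?P le S" for S
      using that by (auto simp: antichain_def)
    have w'w: "w' \<le> w" unfolding w'_def using less.prems(3) mono S0(1) by blast
    have "card ?P < card P" using a less.prems(1) by (intro card_Diff1_less)
    from less.hyps[OF this fin' refl' w'max]
    obtain c :: "'a \<Rightarrow> nat" where c: "\<And>x. x \<in> ?P \<Longrightarrow> c x < w'"
      and ch: "\<And>x y. x \<in> ?P \<Longrightarrow> y \<in> ?P \<Longrightarrow> c x = c y \<Longrightarrow> (x, y) \<in> le \<or> (y, x) \<in> le"
      by blast
    \<comment> \<open>An antichain has at most one point in each chain, so one of size
      \<open>w'\<close> meets all \<open>w'\<close> chains.\<close>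
    have hits: "\<exists>y\<in>S. c y = i" if "antichain ?P le S" "card S = w'" "i < w'" for S i
    proof -
      have SP: "S \<subseteq> ?P" using that(1) by (auto simp: antichain_def)
      have "inj_on c S"
        using that(1) ch SP unfolding antichain_def inj_on_def by blast
      then have "card (c ` S) = w'" using that(2) by (simp add: card_image)
      moreover have "c ` S \<subseteq> {..<w'}" using c SP by auto
      ultimately have "c ` S = {..<w'}" by (intro card_subset_eq) auto
      then have "i \<in> c ` S" using that(3) by simp
      then show ?thesis by (auto simp: image_iff)
    qed
    define X where "X i = {x \<in> ?P. c x = i \<and> (\<exists>S. antichain ?P le S \<and> card S = w' \<and> x \<in> S)}" for i
    have "\<exists>x. x \<in> X i \<and> (\<forall>z\<in>X i. (z, x) \<in> le)" if iw: "i < w'" for i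
    proof -
      obtain y where "y \<in> S0" "c y = i" using hits[OF S0(1) w'_def[symmetric] iw] by blast
      moreover have "S0 \<subseteq> ?P" using S0(1) by (simp add: antichain_def)
      ultimately have "y \<in> X i" unfolding X_def using S0(1) w'_def by blast
      then have ne: "X i \<noteq> {}" by blast
      have finX: "finite (X i)" by (rule finite_subset[OF _ fin']) (auto simp: X_def)
      have "\<exists>x. x \<in> Y \<and> (\<forall>z\<in>Y. (z, x) \<in> le)" if "finite Y" "Y \<noteq> {}" "Y \<subseteq> X i" for Y
        using that
      proof (induction Y rule: finite_ne_induct)
        case (singleton x)
        then have "x \<in> P" by (auto simp: X_def)
        with less.prems(2) show ?case by (auto simp: refl_on_def)
      next
        case (insert y Y)
        then obtain x where x: "x \<in> Y" "\<forall>z\<in>Y. (z, x) \<in> le" by auto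
        have yx: "y \<in> ?P" "x \<in> ?P" "c y = c x" using insert x by (auto simp: X_def)
        have "(y, y) \<in> le" using yx less.prems(2) by (auto simp: refl_on_def)
        from ch[OF yx] show ?case
        proof
          assume "(y, x) \<in> le"
          then show ?thesis using x by (intro exI[of _ x]) auto
        next
          assume "(x, y) \<in> le"
          then have "\<forall>z\<in>Y. (z, y) \<in> le" using x(2) transD[OF tr] by blast
          then show ?thesis using \<open>(y, y) \<in> le\<close> by (intro exI[of _ y]) auto
        qed
      qed
      from this[OF finX ne] show ?thesis by blast
    qed
    then obtain x where x: "\<And>i. i < w' \<Longrightarrow> x i \<in> X i"
      and xmax: "\<And>i z. i < w' \<Longrightarrow> z \<in> X i \<Longrightarrow> (z, x i) \<in> le" by metis
    have xP: "x i \<in> ?P" "c (x i) = i" if "i < w'" for i using x[OF that] by (auto simp: X_def)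
    \<comment> \<open>An antichain of size \<open>w'\<close> through \<open>x j\<close> meets chain
      \<open>i\<close> in some \<open>y\<close> below \<open>x i\<close>. If \<open>x i\<close> were
      below \<open>x j\<close>, then \<open>y\<close> would be comparable to
      \<open>x j\<close>.\<close>
    have incomp: "(x i, x j) \<notin> le" if ij: "i < w'" "j < w'" "i \<noteq> j" for i j
    proof
      assume le: "(x i, x j) \<in> le"
      obtain S where S: "antichain ?P le S" "card S = w'" "x j \<in> S"
        using x[OF ij(2)] by (auto simp: X_def)
      obtain y where y: "y \<in> S" "c y = i" using hits[OF S(1,2) ij(1)] by blast
      then have "y \<in> X i" using S by (auto simp: X_def antichain_def)
      then have "(y, x j) \<in> le" using xmax[OF ij(1)] le transD[OF tr] by blast
      moreover have "y \<noteq> x j" using y(2) xP(2)[OF ij(2)] ij(3) by auto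
      ultimately show False using S y by (auto simp: antichain_def)
    qed
    show ?thesis
    proof (cases "\<exists>i<w'. (x i, a) \<in> le")
      case False
      have inj: "inj_on x {..<w'}" using xP(2) by (intro inj_on_inverseI[of _ c]) auto
      have "antichain P le (insert a (x ` {..<w'}))"
        unfolding antichain_def
      proof (intro conjI ballI impI)
        show "insert a (x ` {..<w'}) \<subseteq> P" using a xP by auto
        fix u v assume uv: "u \<in> insert a (x ` {..<w'})" "v \<in> insert a (x ` {..<w'})" "u \<noteq> v"
        have ax: "(a, x i) \<notin> le" "(x i, a) \<notin> le" if "i < w'" for i
          using amax[of "x i"] xP(1)[OF that] that False by auto
        show "(u, v) \<notin> le" "(v, u) \<notin> le" using uv ax incomp by auto
      qed
      from less.prems(3)[OF this] have "card (insert a (x ` {..<w'})) \<le> w" .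
      moreover have "a \<notin> x ` {..<w'}" using xP(1) by auto
      ultimately have "w' < w" using inj by (simp add: card_image)
      then show ?thesis
      proof (intro exI[of _ "c(a := w')"] conjI ballI impI)
        fix u v assume uv: "u \<in> P" "v \<in> P" "(c(a := w')) u = (c(a := w')) v"
        show "(u, v) \<in> le \<or> (v, u) \<in> le"
        proof (cases "u = a \<or> v = a")
          case True
          then have "u = v" using uv c[of u] c[of v] by (auto split: if_splits)
          then show ?thesis using uv less.prems(2) by (auto simp: refl_on_def)
        qed (use uv ch[of u v] in auto)
      qed (use c w'w in \<open>auto intro: less_trans\<close>)
    next
      case True
      then obtain i where i: "i < w'" "(x i, a) \<in> le" by blast
      define Kc where "Kc = insert a {z \<in> ?P. c z = i \<and> (z, x i) \<in> le}"
      have KP: "Kc \<subseteq> P" using a by (auto simp: Kc_def)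
      have "a \<in> Kc" by (simp add: Kc_def)
      then have card_less: "card (P - Kc) < card P" using a less.prems(1) by (intro psubset_card_mono) auto
      \<comment> \<open>An antichain of size \<open>w'\<close> would meet chain \<open>i\<close> in
        a point of \<open>X i\<close>; this lies below \<open>x i\<close>, hence in
        \<open>Kc\<close>.\<close>
      have anti_le: "card S \<le> w' - 1" if S: "antichain (P - Kc) le S" for S
      proof -
        have S': "antichain ?P le S" using S \<open>a \<in> Kc\<close> by (auto simp: antichain_def)
        have "card S \<noteq> w'"
        proof
          assume "card S = w'"
          from hits[OF S' this i(1)] obtain y where y: "y \<in> S" "c y = i" by blast
          then have "y \<in> X i" using S' \<open>card S = w'\<close> by (auto simp: X_def antichain_def)
          then have "y \<in> Kc" using xmax[OF i(1)] y by (auto simp: Kc_def X_def)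
          then show False using S y by (auto simp: antichain_def)
        qed
        then show ?thesis using w'max[OF S'] by simp
      qed
      have "finite (P - Kc)" using less.prems(1) by simp
      from less.hyps[OF card_less this refl' anti_le]
      obtain c' :: "'a \<Rightarrow> nat" where c': "\<And>x. x \<in> P - Kc \<Longrightarrow> c' x < w' - 1"
        and ch': "\<And>x y. x \<in> P - Kc \<Longrightarrow> y \<in> P - Kc \<Longrightarrow> c' x = c' y \<Longrightarrow> (x, y) \<in> le \<or> (y, x) \<in> le"
        by blast
      have ca: "(z, a) \<in> le" if "z \<in> Kc" for z
        using that i(2) transD[OF tr] a less.prems(2) by (auto simp: Kc_def refl_on_def)
      have chK: "(u, v) \<in> le \<or> (v, u) \<in> le" if "u \<in> Kc" "v \<in> Kc" for u v
      proof (cases "u = a \<or> v = a")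
        case False
        then show ?thesis using that ch[of u v] by (auto simp: Kc_def)
      qed (use ca that in auto)
      show ?thesis
      proof (intro exI[of _ "\<lambda>z. if z \<in> Kc then w' - 1 else c' z"] conjI ballI impI)
        fix u assume u: "u \<in> P"
        show "(if u \<in> Kc then w' - 1 else c' u) < w"
          using c'[of u] u i(1) w'w by (cases "u \<in> Kc") auto
      next
        fix u v assume uv: "u \<in> P" "v \<in> P"
          "(if u \<in> Kc then w' - 1 else c' u) = (if v \<in> Kc then w' - 1 else c' v)"
        show "(u, v) \<in> le \<or> (v, u) \<in> le"
          using uv c'[of u] c'[of v] chK[of u v] ch'[of u v]
          by (cases "u \<in> Kc"; cases "v \<in> Kc") auto
      qed
    qed
  qed simp
qed

section \<open>Width and the order coordinates\<close>

lemma width_attained: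
  assumes "finite P"
  shows "\<exists>S. antichain P le S \<and> card S = width P le"
    and "antichain P le S \<Longrightarrow> card S \<le> width P le"
proof -
  have "finite {S. antichain P le S}"
    by (rule finite_subset[of _ "Pow P"]) (use assms in \<open>auto simp: antichain_def\<close>)
  then have fc: "finite (card ` {S. antichain P le S})" by simp
  have "antichain P le {}" by (simp add: antichain_def)
  then have "card ` {S. antichain P le S} \<noteq> {}" by blast
  from Max_in[OF fc this] show "\<exists>S. antichain P le S \<and> card S = width P le"
    by (auto simp: width_def)
  show "card S \<le> width P le" if "antichain P le S"
    unfolding width_def using fc that by (intro Max_ge) auto
qed

lemma width_le_card:
  assumes "finite P"
  shows "width P le \<le> card P"
proof -
  obtain S where S: "antichain P le S" "card S = width P le" using width_attained(1)[OF assms] by blast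
  then have "card S \<le> card P" using assms by (intro card_mono) (auto simp: antichain_def)
  then show ?thesis using S(2) by simp
qed

text \<open>A chain is linearly ordered, so two of its initial segments are comparable by inclusion and
  hence by cardinality; this turns a chain decomposition into an embedding.\<close>

lemma order_embedding_width:
  fixes le :: "'a rel"
  assumes fin: "finite P" and po: "partial_order_on P le"
  obtains f :: "'a \<Rightarrow> nat \<Rightarrow> nat" where
    "\<And>x y. x \<in> P \<Longrightarrow> y \<in> P \<Longrightarrow> (x, y) \<in> le \<longleftrightarrow> (\<forall>t<width P le. f x t \<le> f y t)"
proof -
  note po' = partial_order_onD[OF po]
  obtain c :: "'a \<Rightarrow> nat" where c: "\<And>x. x \<in> P \<Longrightarrow> c x < width P le"
    and ch: "\<And>x y. x \<in> P \<Longrightarrow> y \<in> P \<Longrightarrow> c x = c y \<Longrightarrow> (x, y) \<in> le \<or> (y, x) \<in> le"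
  proof -
    have "\<exists>c::'a \<Rightarrow> nat. (\<forall>x\<in>P. c x < width P le) \<and>
        (\<forall>x\<in>P. \<forall>y\<in>P. c x = c y \<longrightarrow> (x, y) \<in> le \<or> (y, x) \<in> le)"
      using fin po'(1,2,3) width_attained(2)[OF fin] by (rule dilworth)
    then show ?thesis using that by blast
  qed
  define I where "I x t = {z \<in> P. c z = t \<and> (z, x) \<in> le}" for x t
  have finI: "finite (I x t)" for x t using fin by (simp add: I_def)
  show ?thesis
  proof (rule that[of "\<lambda>x t. card (I x t)"])
    fix x y assume xy: "x \<in> P" "y \<in> P"
    show "(x, y) \<in> le \<longleftrightarrow> (\<forall>t<width P le. card (I x t) \<le> card (I y t))"
    proof
      assume "(x, y) \<in> le"
      then have "I x t \<subseteq> I y t" for t using transD[OF po'(2)] by (auto simp: I_def)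
      then show "\<forall>t<width P le. card (I x t) \<le> card (I y t)" using finI by (simp add: card_mono)
    next
      assume *: "\<forall>t<width P le. card (I x t) \<le> card (I y t)"
      have xI: "x \<in> I x (c x)" using xy po'(1) by (auto simp: I_def refl_on_def)
      show "(x, y) \<in> le"
      proof (rule ccontr)
        assume n: "(x, y) \<notin> le"
        \<comment> \<open>The coordinate of the chain of \<open>x\<close> detects the failure: the
          part of that chain below \<open>y\<close> is a proper initial segment of the part below
          \<open>x\<close>, which contains \<open>x\<close> itself.\<close>
        have "I y (c x) \<subseteq> I x (c x)"
        proof
          fix z assume z: "z \<in> I y (c x)"
          then have "(z, x) \<in> le \<or> (x, z) \<in> le" using ch[of z x] xy by (auto simp: I_def)
          moreover have "(x, z) \<notin> le" using z n transD[OF po'(2)] by (auto simp: I_def)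
          ultimately show "z \<in> I x (c x)" using z by (auto simp: I_def)
        qed
        moreover have "x \<notin> I y (c x)" using n by (simp add: I_def)
        ultimately have "I y (c x) \<subset> I x (c x)" using xI by blast
        from psubset_card_mono[OF finI this] *[rule_format, OF c[OF xy(1)]] show False by simp
      qed
    qed
  qed
qed

section \<open>Realisation by networks\<close>

text \<open>The functional is taken from the moment curve, \<open>v j = e ^ j\<close>. Each pair of
  distinct points gives a nonzero polynomial in \<open>e\<close>, and finitely many of these have
  finitely many roots altogether.\<close>

lemma exists_injective_functional:
  assumes fin: "finite P" and P: "P \<subseteq> vecs N"
  obtains v :: "nat \<Rightarrow> real" where "inj_on (\<lambda>x. \<Sum>j<N. v j * x j) P"
proof -
  \<comment> \<open>The sum includes index \<open>N\<close> to have the standard form of a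
    polynomial; coordinate \<open>N\<close> vanishes on \<open>vecs N\<close>.\<close>
  define Z where "Z x y = {e::real. (\<Sum>j\<le>N. (x j - y j) * e ^ j) = 0}" for x y :: "nat \<Rightarrow> real"
  have finZ: "finite (Z x y)" if "x \<in> P" "y \<in> P" "x \<noteq> y" for x y
  proof -
    obtain j where j: "x j \<noteq> y j" using \<open>x \<noteq> y\<close> by auto
    have "j \<le> N"
    proof (rule ccontr)
      assume "\<not> j \<le> N"
      then have "x j = 0" "y j = 0" using P that by (auto simp: vecs_def)
      then show False using j by simp
    qed
    with j show ?thesis unfolding Z_def polyfun_finite_roots by auto
  qed
  have "finite (\<Union>(x, y)\<in>{(x, y) \<in> P \<times> P. x \<noteq> y}. Z x y)"
    using fin finZ by (intro finite_UN_I finite_subset[of "{(x, y) \<in> P \<times> P. x \<noteq> y}" "P \<times> P"]) auto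
  then obtain e where e: "e \<notin> (\<Union>(x, y)\<in>{(x, y) \<in> P \<times> P. x \<noteq> y}. Z x y)"
    using ex_new_if_finite[OF infinite_UNIV_char_0] by blast
  have "inj_on (\<lambda>x. \<Sum>j<N. e ^ j * x j) P"
  proof (rule inj_onI, rule ccontr)
    fix x y assume xy: "x \<in> P" "y \<in> P" "(\<Sum>j<N. e ^ j * x j) = (\<Sum>j<N. e ^ j * y j)" "x \<noteq> y"
    have "x N = 0" "y N = 0" using P xy by (auto simp: vecs_def)
    then have "(\<Sum>j\<le>N. (x j - y j) * e ^ j) = (\<Sum>j<N. e ^ j * x j) - (\<Sum>j<N. e ^ j * y j)"
      by (simp add: lessThan_Suc_atMost[symmetric] sum_subtractf[symmetric] algebra_simps)
    then have "e \<in> Z x y" using xy by (simp add: Z_def)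
    with e xy show False by auto
  qed
  then show ?thesis by (rule that)
qed

text \<open>Placing each threshold just below the next abscissa makes the interpolation system triangular.\<close>

lemma relu_interpolation:
  fixes X :: "real set"
  assumes "finite X"
  shows "\<exists>\<theta>. \<forall>g. \<exists>c. \<forall>x\<in>X. (\<Sum>i<card X. c i * relu (x - \<theta> i)) = g x"
  using assms
proof (induction X rule: finite_linorder_max_induct)
  case (insert b A)
  then obtain \<theta> where \<theta>: "\<And>g. \<exists>c. \<forall>x\<in>A. (\<Sum>i<card A. c i * relu (x - \<theta> i)) = g x" by blast
  obtain s where s: "s < b" "\<And>x. x \<in> A \<Longrightarrow> x \<le> s"
  proof (cases "A = {}")
    case True
    then show ?thesis by (intro that[of "b - 1"]) auto
  next
    case False
    then show ?thesis using insert.hyps by (intro that[of "Max A"]) auto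
  qed
  have bA: "b \<notin> A" using insert.hyps by auto
  have "\<exists>c. \<forall>x\<in>insert b A. (\<Sum>i<card (insert b A). c i * relu (x - (\<theta>(card A := s)) i)) = g x" for g
  proof -
    obtain c where c: "\<And>x. x \<in> A \<Longrightarrow> (\<Sum>i<card A. c i * relu (x - \<theta> i)) = g x" using \<theta>[of g] by blast
    let ?r = "(g b - (\<Sum>i<card A. c i * relu (b - \<theta> i))) / relu (b - s)"
    have pos: "relu (b - s) \<noteq> 0" using s(1) by (simp add: relu_def)
    have zero: "relu (x - s) = 0" if "x \<in> A" for x using s(2)[OF that] by (simp add: relu_def)
    show ?thesis
      by (rule exI[of _ "c(card A := ?r)"]) (use insert.hyps bA c pos zero in auto)
  qed
  then show ?case by blast
qed simp

section \<open>Networks and their parameter counts\<close>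

lemma nnz_mat_le: "nnz_mat m n A \<le> m * n"
proof -
  have "nnz_mat m n A \<le> card ({..<m} \<times> {..<n})"
    unfolding nnz_mat_def by (rule card_mono) auto
  then show ?thesis by simp
qed

lemma nnz_vec_le: "nnz_vec m v \<le> m"
proof -
  have "nnz_vec m v \<le> card {..<m}"
    unfolding nnz_vec_def by (rule card_mono) auto
  then show ?thesis by simp
qed

text \<open>An injective functional reduces the problem to one variable. The knots
  \<open>\<theta>\<close> are chosen before the values, so all \<open>m\<close> outputs share one
  hidden layer of width \<open>card P\<close>, and only the last layer depends on
  \<open>g\<close>.\<close>

lemma mlp_interpolation:
  fixes g :: "(nat \<Rightarrow> real) \<Rightarrow> nat \<Rightarrow> real"
  assumes fin: "finite P" and ne: "P \<noteq> {}" and P: "P \<subseteq> vecs N" and N: "N > 0" and m: "m > 0"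
  obtains E where "mlp_valid N m E" "\<And>x i. x \<in> P \<Longrightarrow> i < m \<Longrightarrow> mlp_eval E x i = g x i"
    "mlp_nnz E \<le> card P * N + card P + m * card P"
proof -
  obtain v where v: "inj_on (\<lambda>x. \<Sum>j<N. v j * x j) P"
    using exists_injective_functional[OF fin P] by blast
  let ?L = "\<lambda>x. \<Sum>j<N. v j * x j"
  let ?k = "card P"
  have k: "card (?L ` P) = ?k" using v by (rule card_image)
  obtain \<theta> where \<theta>: "\<And>h. \<exists>c. \<forall>x\<in>?L ` P. (\<Sum>i<?k. c i * relu (x - \<theta> i)) = h x"
    using relu_interpolation[of "?L ` P"] fin unfolding k by blast
  have "\<exists>c. \<forall>x\<in>P. (\<Sum>j<?k. c j * relu (?L x - \<theta> j)) = g x i" for i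
    using \<theta>[of "\<lambda>s. g (the_inv_into P ?L s) i"] by (simp add: the_inv_into_f_f[OF v])
  then obtain c where c: "\<And>x i. x \<in> P \<Longrightarrow> (\<Sum>j<?k. c i j * relu (?L x - \<theta> j)) = g x i" by metis
  define E where "E = \<lparr>mlp_dims = [N, ?k, m], mlp_W = (\<lambda>l i j. if l = 0 then v j else c i j),
    mlp_b = (\<lambda>l i. if l = 0 then - \<theta> i else 0)\<rparr>"
  have kpos: "?k > 0" using fin ne by (simp add: card_gt_0_iff)
  have depth: "mlp_depth E = 2" by (simp add: mlp_depth_def E_def)
  show ?thesis
  proof
    show "mlp_valid N m E" using kpos N m by (simp add: mlp_valid_def E_def)
    show "mlp_eval E x i = g x i" if x: "x \<in> P" "i < m" for x i
    proof -
      have "mlp_hidden E x (Suc 0) j = relu (?L x - \<theta> j)" if "j < ?k" for j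
        using that by (simp add: mlp_affine_def) (simp add: E_def)
      then have "mlp_eval E x i = (\<Sum>j<?k. c i j * relu (?L x - \<theta> j))"
        using x unfolding mlp_eval_def depth by (simp add: mlp_affine_def E_def)
      then show ?thesis using c[OF x(1)] by simp
    qed
    have "mlp_nnz E = (nnz_mat ?k N (\<lambda>i j. v j) + nnz_vec ?k (\<lambda>i. - \<theta> i))
        + (nnz_mat m ?k c + nnz_vec m (\<lambda>i. 0))"
      unfolding mlp_nnz_def depth by (simp add: E_def numeral_2_eq_2)
    also have "\<dots> \<le> (?k * N + ?k) + (m * ?k + 0)"
      by (intro add_mono nnz_mat_le nnz_vec_le) (simp add: nnz_vec_def)
    finally show "mlp_nnz E \<le> ?k * N + ?k + m * ?k" by simp
  qed
qed

lemma sig_same: "sig p p x = sgn1 x * \<bar>x\<bar> powr p"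
  by (simp add: sig_def)

lemma sig_one: "sig 1 1 x = x"
  by (simp add: sig_same sgn1_def)

text \<open>Since \<open>E\<close> can produce any coordinates on \<open>P\<close>, one layer
  suffices on each side: exponents 1 and \<open>p\<close> with constant weight \<open>w\<close> for
  the metric, the identity matrix with exponent 1 and zero bias for the order. The count is
  \<open>D + 6\<close>: four exponents and \<open>D\<close> weights, then one exponent and one
  diagonal factor.\<close>

lemma realise_by_networks:
  fixes F :: "(nat \<Rightarrow> real) \<Rightarrow> nat \<Rightarrow> real"
  assumes fin: "finite P" and ne: "P \<noteq> {}" and P: "P \<subseteq> vecs N" and N: "N > 0" and D: "D > 0"
    and po: "partial_order_on P le" and p: "p > 0" and w: "w > 0"
  obtains E pD pT where "mlp_valid N (D + width P le) E" "nqm_valid D pD" "npo_valid (width P le) pT"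
    "\<And>x y. x \<in> P \<Longrightarrow> y \<in> P \<Longrightarrow> (x, y) \<in> le \<longleftrightarrow>
       pord (width P le) (npo_eval a D (width P le) pT (mlp_eval E x)) (npo_eval a D (width P le) pT (mlp_eval E y))"
    "\<And>x y. x \<in> P \<Longrightarrow> y \<in> P \<Longrightarrow>
       nqm_eval D pD (mlp_eval E x) (mlp_eval E y) = (\<Sum>i<D. w * \<bar>F x i - F y i\<bar> powr p)"
    "nqm_nnz D pD + npo_nnz (width P le) pT \<le> D + width P le + 8"
    "mlp_nnz E \<le> card P * N + card P + (D + width P le) * card P"
proof -
  let ?W = "width P le"
  obtain f :: "(nat \<Rightarrow> real) \<Rightarrow> nat \<Rightarrow> nat" where
    f: "\<And>x y. x \<in> P \<Longrightarrow> y \<in> P \<Longrightarrow> (x, y) \<in> le \<longleftrightarrow> (\<forall>t<?W. f x t \<le> f y t)"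
    using order_embedding_width[OF fin po] by blast
  define g where "g x i = (if i < D then F x i else real (f x (i - D)))" for x i
  have "D + ?W > 0" using D by simp
  from mlp_interpolation[OF fin ne P N this, of g]
  obtain E where E: "mlp_valid N (D + ?W) E" "\<And>x i. x \<in> P \<Longrightarrow> i < D + ?W \<Longrightarrow> mlp_eval E x i = g x i"
    "mlp_nnz E \<le> card P * N + card P + (D + ?W) * card P" by blast
  define pD where "pD = \<lparr>nqm_J = 1, nqm_s = (\<lambda>j. if j = 0 then 1 else p), nqm_l = (\<lambda>j. if j = 0 then 1 else p),
     nqm_lam = (\<lambda>_. 1), nqm_Wt = (\<lambda>_ _ _. 0), nqm_WJ = (\<lambda>_. w)\<rparr>"
  define pT where "pT = \<lparr>npo_J = 1, npo_s = (\<lambda>_. 1), npo_lam = (\<lambda>_. 1), npo_Wt = (\<lambda>_ _ _. 0),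
     npo_b = (\<lambda>_ _. 0)\<rparr>"
  have T: "npo_eval a D ?W pT z t = LR a (z (D + t))" if "t < ?W" for z t
  proof -
    have "(\<Sum>j<?W. (if t = j then 1 else 0) * LR a (if j < ?W then z (D + j) else 0))
      = (\<Sum>j<?W. if j = t then LR a (z (D + j)) else 0)"
      by (rule sum.cong) auto
    then show ?thesis using that
      by (simp add: npo_eval_def pT_def mv_def Iplus_mat_def sig_one)
  qed
  show ?thesis
  proof
    show "mlp_valid N (D + ?W) E" "mlp_nnz E \<le> card P * N + card P + (D + ?W) * card P" by fact+
    show "nqm_valid D pD" "npo_valid ?W pT"
      using p w by (auto simp: nqm_valid_def npo_valid_def pD_def pT_def)
    fix x y assume xy: "x \<in> P" "y \<in> P"
    \<comment> \<open>The order coordinates are counts, hence nonnegative, so \<open>LR a\<close>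
      fixes them.\<close>
    have "npo_eval a D ?W pT (mlp_eval E z) t = real (f z t)" if "z \<in> P" "t < ?W" for z t
      using that by (simp add: T E(2) g_def LR_def)
    then show "(x, y) \<in> le \<longleftrightarrow>
       pord ?W (npo_eval a D ?W pT (mlp_eval E x)) (npo_eval a D ?W pT (mlp_eval E y))"
      using xy by (simp add: pord_def f)
    show "nqm_eval D pD (mlp_eval E x) (mlp_eval E y) = (\<Sum>i<D. w * \<bar>F x i - F y i\<bar> powr p)"
      unfolding nqm_eval_def
      by (rule sum.cong) (use xy in \<open>auto simp: pD_def sig_one sig_same sgn1_def E(2) g_def\<close>)
  next
    have "card {j. j \<le> nqm_J pD \<and> h j \<noteq> 0} \<le> 2" for h :: "nat \<Rightarrow> real"
      using card_mono[of "{..1::nat}" "{j. j \<le> nqm_J pD \<and> h j \<noteq> 0}"]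
      by (simp add: pD_def subset_eq)
    from add_mono[OF this[of "nqm_s pD"] this[of "nqm_l pD"]] have "nqm_nnz D pD \<le> 4 + D"
      unfolding nqm_nnz_def using nnz_vec_le[of D "nqm_WJ pD"] by (simp add: pD_def)
    moreover have "npo_nnz ?W pT = 2"
      by (simp add: npo_nnz_def pT_def nnz_mat_def nnz_vec_def)
    ultimately show "nqm_nnz D pD + npo_nnz ?W pT \<le> D + ?W + 8" by simp
  qed
qed

section \<open>Parameter bounds and the final constants\<close>

lemma lg_ge_1: "1 \<le> lg x"
  by (simp add: lg_def)

text \<open>The least number exists because a finite space is covered by balls around all its
  points; \<open>Suc\<close> makes the candidate at least 1 even for the empty space.\<close>

lemma (in Metric_space) doubling_doubling_const:
  assumes "finite M"
  shows "doubling M d (doubling_const M d)"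
proof -
  have "\<exists>C. C \<subseteq> M \<and> finite C \<and> card C \<le> Suc (card M) \<and>
     {y\<in>M. d x y < r} \<subseteq> (\<Union>c\<in>C. {y\<in>M. d c y < r / 2})" if "0 < r" for x r
  proof (intro exI[of _ M] conjI)
    show "{y\<in>M. d x y < r} \<subseteq> (\<Union>c\<in>M. {y\<in>M. d c y < r / 2})"
    proof
      fix y assume "y \<in> {y\<in>M. d x y < r}"
      then have "y \<in> {z\<in>M. d y z < r / 2}" "y \<in> M" using that by auto
      then show "y \<in> (\<Union>c\<in>M. {y\<in>M. d c y < r / 2})" by blast
    qed
  qed (use assms in auto)
  then have "doubling M d (Suc (card M))" unfolding doubling_def by simp
  then show ?thesis
    unfolding doubling_const_def doubling_def by (rule LeastI)
qed

text \<open>Each of the four summands of the encoder count is at most \<open>Y\<close>, the one with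
  the width because the width is at most the number of points. \<open>Y\<close> is below
  \<open>X\<close> since the logarithmic factors are at least 1; \<open>L\<close> stands for the
  factor of diameter and separation.\<close>

lemma realise_with_parameter_bounds:
  fixes F :: "(nat \<Rightarrow> real) \<Rightarrow> nat \<Rightarrow> real" and X L C :: real
  assumes fin: "finite P" and ne: "P \<noteq> {}" and P: "P \<subseteq> vecs N" and N: "N > 0" and D: "D > 0"
    and po: "partial_order_on P le" and p: "p > 0" and w: "w > 0" and L: "1 \<le> L" and C: "9 \<le> C"
  defines "X \<equiv> real (card P) powr (5/2) * real D ^ 4 * real N * lg (real N) * L"
  obtains E pD pT where "mlp_valid N (D + width P le) E" "nqm_valid D pD" "npo_valid (width P le) pT"
    "\<forall>x\<in>P. \<forall>y\<in>P. (x, y) \<in> le \<longleftrightarrow>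
       pord (width P le) (npo_eval a D (width P le) pT (mlp_eval E x)) (npo_eval a D (width P le) pT (mlp_eval E y))"
    "\<And>x y. x \<in> P \<Longrightarrow> y \<in> P \<Longrightarrow>
       nqm_eval D pD (mlp_eval E x) (mlp_eval E y) = (\<Sum>i<D. w * \<bar>F x i - F y i\<bar> powr p)"
    "nqm_nnz D pD + npo_nnz (width P le) pT \<le> D + width P le + 8"
    "real (mlp_nnz E) \<le> C * X"
    "real (nqm_nnz D pD + npo_nnz (width P le) pT + mlp_nnz E) \<le> C * (real D + real (width P le) + X)"
proof -
  let ?W = "width P le" and ?k = "card P"
  obtain E pD pT where E: "mlp_valid N (D + ?W) E" "nqm_valid D pD" "npo_valid ?W pT"
    "\<And>x y. x \<in> P \<Longrightarrow> y \<in> P \<Longrightarrow> (x, y) \<in> le \<longleftrightarrow>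
       pord ?W (npo_eval a D ?W pT (mlp_eval E x)) (npo_eval a D ?W pT (mlp_eval E y))"
    "\<And>x y. x \<in> P \<Longrightarrow> y \<in> P \<Longrightarrow>
       nqm_eval D pD (mlp_eval E x) (mlp_eval E y) = (\<Sum>i<D. w * \<bar>F x i - F y i\<bar> powr p)"
    "nqm_nnz D pD + npo_nnz ?W pT \<le> D + ?W + 8"
    "mlp_nnz E \<le> ?k * N + ?k + (D + ?W) * ?k"
    by (rule realise_by_networks[OF fin ne P N D po p w, of a F]) (rule that)
  have k: "1 \<le> ?k" using fin ne by (simp add: Suc_le_eq card_gt_0_iff)
  have W: "?W \<le> ?k" using width_le_card[OF fin] .
  define Y where "Y = ?k ^ 2 * D ^ 4 * N"
  have kD: "?k \<le> ?k ^ 2" "1 \<le> D ^ 4" "D \<le> D ^ 4"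
    using k D by (auto simp: power2_eq_square self_le_power)
  have "?k * N \<le> Y"
    unfolding Y_def using mult_le_mono[OF mult_le_mono[OF kD(1,2)] le_refl[of N]] by simp
  moreover have "?k \<le> ?k * N" using N by simp
  moreover have "D * ?k \<le> Y"
    unfolding Y_def using mult_le_mono[OF mult_le_mono[OF kD(1,3)], of 1 N] N by (simp add: mult.commute)
  moreover have "?W * ?k \<le> Y"
  proof -
    have "?W * ?k \<le> ?k ^ 2 * 1 * 1" using W by (simp add: power2_eq_square)
    also have "\<dots> \<le> Y" unfolding Y_def by (intro mult_le_mono kD) (use N in auto)
    finally show ?thesis .
  qed
  ultimately have "mlp_nnz E \<le> 4 * Y" using E(7) unfolding distrib_right by linarith
  then have "real (mlp_nnz E) \<le> 4 * real Y" by (metis of_nat_le_iff of_nat_mult of_nat_numeral)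
  also have "real Y \<le> X"
  proof -
    have "real Y = real ?k powr 2 * real D ^ 4 * real N * 1 * 1" using k by (simp add: Y_def)
    also have "\<dots> \<le> X" unfolding X_def
      by (intro mult_mono powr_mono lg_ge_1 L) (use k lg_ge_1[of "real N"] in auto)
    finally show ?thesis .
  qed
  finally have mlp: "real (mlp_nnz E) \<le> 4 * X" by simp
  have X0: "0 \<le> X" unfolding X_def using lg_ge_1[of "real N"] L by auto
  show ?thesis
  proof (rule that[OF E(1-3) _ E(5,6)])
    show "real (mlp_nnz E) \<le> C * X" using mlp mult_right_mono[of 4 C X] C X0 by simp
    have "real (nqm_nnz D pD + npo_nnz ?W pT) \<le> real (D + ?W + 8)" unfolding of_nat_le_iff by (rule E(6))
    \<comment> \<open>The summand 8 is absorbed by \<open>8 * D\<close>, as \<open>D\<close> is at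
      least 1; hence 9.\<close>
    then have "real (nqm_nnz D pD + npo_nnz ?W pT + mlp_nnz E) \<le> 9 * (real D + real ?W + X)"
      using mlp D X0 by simp
    also have "\<dots> \<le> C * (real D + real ?W + X)" using C X0 by (intro mult_right_mono) auto
    finally show "real (nqm_nnz D pD + npo_nnz ?W pT + mlp_nnz E) \<le> C * (real D + real ?W + X)" .
  qed (use E(4) in blast)
qed

text \<open>From \<open>ln 2 \<ge> 2 / 3\<close> one gets a factor 3/2, and rounding up costs at
  most another \<open>lg K\<close>; 3 covers both.\<close>

lemma exists_binary_exponent:
  assumes "1 \<le> K"
  obtains a :: nat where "1 \<le> a" "K \<le> 2 ^ a" "real a \<le> 3 * lg (real K)"
proof -
  obtain n where n: "2 ^ n \<le> K" "K < 2 ^ (n + 1)" using ex_power_ivl1[of 2 K] assms by auto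
  have "real n * (2 / 3) \<le> real n * ln 2" using ln2_ge_two_thirds by (intro mult_left_mono) auto
  also have "\<dots> = ln (2 ^ n)" by (simp add: ln_realpow)
  also have "\<dots> \<le> ln (real K)"
  proof -
    have "real (2 ^ n) \<le> real K" unfolding of_nat_le_iff by (rule n(1))
    then show ?thesis using assms by (subst ln_le_cancel_iff) auto
  qed
  also have "\<dots> \<le> lg (real K)" using assms by (simp add: lg_def)
  finally have "real (n + 1) \<le> 3 * lg (real K)" using lg_ge_1[of "real K"] by simp
  then show ?thesis using n by (intro that[of "n + 1"]) auto
qed

theorem mainTheorem1:
  shows "\<exists>C::real. C > 0 \<and>
   (\<forall>(a::real) (N::nat) (W::nat) (k::nat) (K::nat) (P::(nat \<Rightarrow> real) set)
      (d::(nat \<Rightarrow> real) \<Rightarrow> (nat \<Rightarrow> real) \<Rightarrow> real) (le::(nat \<Rightarrow> real) rel).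
     0 < a \<and> a < 1 \<and> N > 0 \<and> W > 0 \<and> k > 0 \<and>
     P \<subseteq> vecs N \<and> finite P \<and> card P = k \<and> causal_metric_space P d le \<and>
     doubling_const P d = K \<and> width P le = W
     \<longrightarrow>
     (\<exists>(D::nat) (E::mlp) (pD::nqm_params) (pT::npo_params).
        D > 0 \<and> real D \<le> C * lg (real K) \<and>
        mlp_valid N (D + W) E \<and> nqm_valid D pD \<and> npo_valid W pT \<and>
        (\<forall>x\<in>P. \<forall>y\<in>P. (x, y) \<in> le \<longleftrightarrow>
            pord W (npo_eval a D W pT (mlp_eval E x)) (npo_eval a D W pT (mlp_eval E y))) \<and>
        (\<forall>x\<in>P. \<forall>y\<in>P. d x y \<le> nqm_eval D pD (mlp_eval E x) (mlp_eval E y) \<and>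
            nqm_eval D pD (mlp_eval E x) (mlp_eval E y) \<le> C * lg (real K) ^ 5 * d x y) \<and>
        nqm_nnz D pD + npo_nnz W pT \<le> D + W + 8 \<and>
        real (mlp_nnz E) \<le> C * (real k powr (5/2) * real D ^ 4 * real N * lg (real N)
            * lg (real k ^ 2 * diam_sp P d / sep_sp P d)) \<and>
        real (nqm_nnz D pD + npo_nnz W pT + mlp_nnz E) \<le> C * (real D + real W
            + real k powr (5/2) * real D ^ 4 * real N * lg (real N)
              * lg (real k ^ 2 * diam_sp P d / sep_sp P d)))
     \<and>
     (\<exists>(D::nat) (E::mlp) (pD::nqm_params) (pT::npo_params).
        D > 0 \<and> D \<le> k \<and>
        mlp_valid N (D + W) E \<and> nqm_valid D pD \<and> npo_valid W pT \<and>
        (\<forall>x\<in>P. \<forall>y\<in>P. (x, y) \<in> le \<longleftrightarrow>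
            pord W (npo_eval a D W pT (mlp_eval E x)) (npo_eval a D W pT (mlp_eval E y))) \<and>
        (\<forall>x\<in>P. \<forall>y\<in>P. d x y = nqm_eval D pD (mlp_eval E x) (mlp_eval E y)) \<and>
        nqm_nnz D pD + npo_nnz W pT \<le> D + W + 8 \<and>
        real (mlp_nnz E) \<le> C * (real k powr (5/2) * real D ^ 4 * real N * lg (real N)
            * lg (real k ^ 2 * diam_sp P d / sep_sp P d)) \<and>
        real (nqm_nnz D pD + npo_nnz W pT + mlp_nnz E) \<le> C * (real D + real W
            + real k powr (5/2) * real D ^ 4 * real N * lg (real N)
              * lg (real k ^ 2 * diam_sp P d / sep_sp P d))))"
proof -
  \<comment> \<open>Since \<open>b \<le> 3 * lg K\<close>, the dimension gives
    \<open>1200 = 400 * 3\<close> and the distortion gives \<open>243 = 3 ^ 5\<close>.\<close>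
  define C where "C = max 1200 (distortion_const * 243)"
  have C: "9 \<le> C" "1200 \<le> C" "distortion_const * 243 \<le> C" by (auto simp: C_def)
  show ?thesis
  proof (intro exI[of _ C] conjI allI impI; (elim conjE)?)
    show "0 < C" using C by simp
  next
    fix a :: real and N W k K :: nat and P :: "(nat \<Rightarrow> real) set" and d and le :: "(nat \<Rightarrow> real) rel"
    assume N: "N > 0" and k: "k > 0" and P: "P \<subseteq> vecs N" and fin: "finite P" and card: "card P = k"
      and cms: "causal_metric_space P d le" and K: "doubling_const P d = K" and W: "width P le = W"
    interpret Metric_space P d using cms by (simp add: causal_metric_space_def)
    have po: "partial_order_on P le" using cms by (simp add: causal_metric_space_def)
    have ne: "P \<noteq> {}" using card k by auto
    have dbl: "doubling P d K" using doubling_doubling_const[OF fin] K by simp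
    then have K1: "1 \<le> K" by (simp add: doubling_def)
    obtain b where b: "1 \<le> b" "K \<le> 2 ^ b" "real b \<le> 3 * lg (real K)" using exists_binary_exponent[OF K1] .
    obtain F :: "(nat \<Rightarrow> real) \<Rightarrow> nat \<Rightarrow> real" and w :: real where w: "0 < w"
      and lo: "\<And>x y. x \<in> P \<Longrightarrow> y \<in> P \<Longrightarrow> d x y \<le> (\<Sum>i<400 * b. w * (F x i - F y i)\<^sup>2)"
      and up: "\<And>x y. x \<in> P \<Longrightarrow> y \<in> P \<Longrightarrow>
        (\<Sum>i<400 * b. w * (F x i - F y i)\<^sup>2) \<le> distortion_const * real b ^ 5 * d x y"
      by (rule doubling_snowflake_embedding[OF fin ne dbl b(2,1)]) (rule that)
    \<comment> \<open>One realisation serves both claims: with \<open>400 * b\<close> coordinates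
      and exponent 2 for the logarithmic dimension, with \<open>k\<close> coordinates and exponent
      \<open>p\<close> for the exact metric.\<close>
    note real = realise_with_parameter_bounds[OF fin ne P N _ po _ _ lg_ge_1 C(1), unfolded card W]
    have D: "400 * b > 0" using b(1) by simp
    have C5: "distortion_const * real b ^ 5 * d x y \<le> C * lg (real K) ^ 5 * d x y" for x y
    proof (rule mult_right_mono)
      have "distortion_const * real b ^ 5 \<le> distortion_const * (3 * lg (real K)) ^ 5"
        using b(3) by (intro mult_left_mono power_mono) (auto simp: distortion_const_def)
      also have "\<dots> = distortion_const * 243 * lg (real K) ^ 5" by (simp add: power_mult_distrib)
      also have "\<dots> \<le> C * lg (real K) ^ 5"
        using C(3) lg_ge_1[of "real K"] by (intro mult_right_mono zero_le_power) auto
      finally show "distortion_const * real b ^ 5 \<le> C * lg (real K) ^ 5" .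
    qed simp
    have sq: "\<bar>u\<bar> powr 2 = u\<^sup>2" for u :: real by (cases "u = 0") (auto simp: powr_numeral)
    obtain E pD pT where E: "mlp_valid N (400 * b + W) E" "nqm_valid (400 * b) pD" "npo_valid W pT"
      "\<forall>x\<in>P. \<forall>y\<in>P. (x, y) \<in> le \<longleftrightarrow>
        pord W (npo_eval a (400 * b) W pT (mlp_eval E x)) (npo_eval a (400 * b) W pT (mlp_eval E y))"
      "\<And>x y. x \<in> P \<Longrightarrow> y \<in> P \<Longrightarrow> nqm_eval (400 * b) pD (mlp_eval E x) (mlp_eval E y)
        = (\<Sum>i<400 * b. w * \<bar>F x i - F y i\<bar> powr 2)"
      "nqm_nnz (400 * b) pD + npo_nnz W pT \<le> 400 * b + W + 8"
      "real (mlp_nnz E) \<le> C * (real k powr (5/2) * real (400 * b) ^ 4 * real N * lg (real N)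
          * lg (real k ^ 2 * diam_sp P d / sep_sp P d))"
      "real (nqm_nnz (400 * b) pD + npo_nnz W pT + mlp_nnz E) \<le> C * (real (400 * b) + real W
          + real k powr (5/2) * real (400 * b) ^ 4 * real N * lg (real N)
            * lg (real k ^ 2 * diam_sp P d / sep_sp P d))"
      by (rule real[OF D _ w, of 2]) (simp, rule that)
    have dist: "\<forall>x\<in>P. \<forall>y\<in>P. d x y \<le> nqm_eval (400 * b) pD (mlp_eval E x) (mlp_eval E y) \<and>
            nqm_eval (400 * b) pD (mlp_eval E x) (mlp_eval E y) \<le> C * lg (real K) ^ 5 * d x y"
      using lo order_trans[OF up C5] by (simp add: E(5) sq)
    have Dlg: "real (400 * b) \<le> C * lg (real K)"
    proof -
      have "real (400 * b) \<le> 1200 * lg (real K)" using b(3) by simp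
      also have "\<dots> \<le> C * lg (real K)" using C(2) lg_ge_1[of "real K"] by (intro mult_right_mono) auto
      finally show ?thesis .
    qed
    show "\<exists>(D::nat) (E::mlp) (pD::nqm_params) (pT::npo_params).
        D > 0 \<and> real D \<le> C * lg (real K) \<and>
        mlp_valid N (D + W) E \<and> nqm_valid D pD \<and> npo_valid W pT \<and>
        (\<forall>x\<in>P. \<forall>y\<in>P. (x, y) \<in> le \<longleftrightarrow>
            pord W (npo_eval a D W pT (mlp_eval E x)) (npo_eval a D W pT (mlp_eval E y))) \<and>
        (\<forall>x\<in>P. \<forall>y\<in>P. d x y \<le> nqm_eval D pD (mlp_eval E x) (mlp_eval E y) \<and>
            nqm_eval D pD (mlp_eval E x) (mlp_eval E y) \<le> C * lg (real K) ^ 5 * d x y) \<and>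
        nqm_nnz D pD + npo_nnz W pT \<le> D + W + 8 \<and>
        real (mlp_nnz E) \<le> C * (real k powr (5/2) * real D ^ 4 * real N * lg (real N)
            * lg (real k ^ 2 * diam_sp P d / sep_sp P d)) \<and>
        real (nqm_nnz D pD + npo_nnz W pT + mlp_nnz E) \<le> C * (real D + real W
            + real k powr (5/2) * real D ^ 4 * real N * lg (real N)
              * lg (real k ^ 2 * diam_sp P d / sep_sp P d))"
      by (intro exI[of _ "400 * b"] exI[of _ E] exI[of _ pD] exI[of _ pT] conjI D Dlg dist E(1-4) E(6-8))
    obtain p :: nat and w' :: real and F' :: "(nat \<Rightarrow> real) \<Rightarrow> nat \<Rightarrow> real" where p: "0 < p" and w': "0 < w'"
      and ex: "\<And>x y. x \<in> P \<Longrightarrow> y \<in> P \<Longrightarrow> d x y = (\<Sum>i<k. w' * \<bar>F' x i - F' y i\<bar> ^ p)"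
      by (rule exact_power_embedding[OF fin, unfolded card]) (rule that)
    have pw: "\<bar>u\<bar> powr real p = \<bar>u\<bar> ^ p" for u :: real
      using p by (cases "u = 0") (auto simp: powr_realpow)
    obtain E' pD' pT' where E': "mlp_valid N (k + W) E'" "nqm_valid k pD'" "npo_valid W pT'"
      "\<forall>x\<in>P. \<forall>y\<in>P. (x, y) \<in> le \<longleftrightarrow>
        pord W (npo_eval a k W pT' (mlp_eval E' x)) (npo_eval a k W pT' (mlp_eval E' y))"
      "\<And>x y. x \<in> P \<Longrightarrow> y \<in> P \<Longrightarrow> nqm_eval k pD' (mlp_eval E' x) (mlp_eval E' y)
        = (\<Sum>i<k. w' * \<bar>F' x i - F' y i\<bar> powr real p)"
      "nqm_nnz k pD' + npo_nnz W pT' \<le> k + W + 8"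
      "real (mlp_nnz E') \<le> C * (real k powr (5/2) * real k ^ 4 * real N * lg (real N)
          * lg (real k ^ 2 * diam_sp P d / sep_sp P d))"
      "real (nqm_nnz k pD' + npo_nnz W pT' + mlp_nnz E') \<le> C * (real k + real W
          + real k powr (5/2) * real k ^ 4 * real N * lg (real N)
            * lg (real k ^ 2 * diam_sp P d / sep_sp P d))"
      by (rule real[OF k _ w', of "real p"]) (use p in simp, rule that)
    have dist': "\<forall>x\<in>P. \<forall>y\<in>P. d x y = nqm_eval k pD' (mlp_eval E' x) (mlp_eval E' y)"
      by (simp add: E'(5) pw ex)
    show "\<exists>(D::nat) (E::mlp) (pD::nqm_params) (pT::npo_params).
        D > 0 \<and> D \<le> k \<and>
        mlp_valid N (D + W) E \<and> nqm_valid D pD \<and> npo_valid W pT \<and>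
        (\<forall>x\<in>P. \<forall>y\<in>P. (x, y) \<in> le \<longleftrightarrow>
            pord W (npo_eval a D W pT (mlp_eval E x)) (npo_eval a D W pT (mlp_eval E y))) \<and>
        (\<forall>x\<in>P. \<forall>y\<in>P. d x y = nqm_eval D pD (mlp_eval E x) (mlp_eval E y)) \<and>
        nqm_nnz D pD + npo_nnz W pT \<le> D + W + 8 \<and>
        real (mlp_nnz E) \<le> C * (real k powr (5/2) * real D ^ 4 * real N * lg (real N)
            * lg (real k ^ 2 * diam_sp P d / sep_sp P d)) \<and>
        real (nqm_nnz D pD + npo_nnz W pT + mlp_nnz E) \<le> C * (real D + real W
            + real k powr (5/2) * real D ^ 4 * real N * lg (real N)
              * lg (real k ^ 2 * diam_sp P d / sep_sp P d))"
      by (intro exI[of _ k] exI[of _ E'] exI[of _ pD'] exI[of _ pT'] conjI k le_refl dist' E'(1-4) E'(6-8))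
  qed
qed

end
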